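(* Let $L$ be a finite lattice that is rank-connected and dismantlable. Then $L$ is lexicographically shellable.
   Context: A finite lattice has a least element $\hat{0}$ and a greatest element $\hat{1}$; it is trivial if it has only these two elements. $L$ is ranked if every maximal chain from $\hat{0}$ to $\hat{1}$ has the same length; then $r(x)$ is the length of a maximal chain from $\hat{0}$ to $x$, and $R_i$ is the set of elements of rank $i$. $L$ is rank-connected if it is ranked and, for every $0\le i<r(\hat{1})$, the subgraph of the Hasse diagram induced by $R_i\cup R_{i+1}$ is connected. An element is doubly irreducible if it covers exactly one element and is covered by exactly one element. $L$ is dismantlable if there is a chain of sublattices $L_1\subseteq L_2\subseteq\cdots\subseteq L_n=L$ with $|L_i|=i$ for each $i$ (equivalently, every non-trivial sublattice of $L$ has a doubly irreducible element). A ranked lattice $L$ with set of covering relations $C(L)$ is lexicographically shellable if there is a labeling $f:C(L)\to\mathbb{R}$ such that (1) in every interval $[x,y]$ there is a unique unrefinable chain $x=x_0<x_1<\dots<x_n=y$ with $f(x_0,x_1)\le f(x_1,x_2)\le\dots\le f(x_{n-1},x_n)$, and (2) for every interval $[x,y]$, if $x=x_0<\dots<x_n=y$ is this unique rising chain and $z\in[x,y]$ covers $x$ with $z\ne x_1$, then $f(x,x_1)<f(x,z)$. *)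

theory Defs
  imports Complex_Main "HOL-Library.Cardinality" "Graph_Theory.Graph_Theory"
begin

text \<open>
  A finite lattice is a type of class \<open>{finite, bounded_lattice}\<close>; a property of the lattice as a
  whole takes a \<open>TYPE('a)\<close> argument. The bounds \<open>bot\<close> and \<open>top\<close>, which every nonempty finite
  lattice has, are the elements 0 and 1 of the lattice.
\<close>

definition covered_by :: "'a::order \<Rightarrow> 'a \<Rightarrow> bool"  (infix \<open>\<lessdot>\<close> 50)
  where "x \<lessdot> y \<longleftrightarrow> x < y \<and> (\<nexists>z. x < z \<and> z < y)"

abbreviation maximal_chain :: "'a::order \<Rightarrow> 'a \<Rightarrow> 'a set \<Rightarrow> bool"
  where "maximal_chain x y \<equiv> pred_on.maxchain {x..y} (<)"

definition chain_length :: "'a set \<Rightarrow> nat"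
  where "chain_length C = card C - 1"

definition ranked :: "'a::{finite, bounded_lattice} itself \<Rightarrow> bool"
  where "ranked L \<longleftrightarrow>
    (\<forall>(C :: 'a set) (D :: 'a set). maximal_chain bot top C \<longrightarrow> maximal_chain bot top D \<longrightarrow>
      chain_length C = chain_length D)"

text \<open>Only meaningful when the lattice is ranked: otherwise the length need not be unique.\<close>

definition rank :: "'a::{finite, bounded_lattice} \<Rightarrow> nat"
  where "rank x = (THE k. \<exists>C. maximal_chain bot x C \<and> chain_length C = k)"

definition rank_level :: "nat \<Rightarrow> 'a::{finite, bounded_lattice} set"
  where "rank_level i = {x. rank x = i}"

text \<open>
  The Hasse diagram is stored with its edges directed upwards; connectedness of a digraph in
  \<^theory>\<open>Graph_Theory.Digraph_Component\<close> refers to the underlying undirected graph.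
\<close>

definition hasse_diagram :: "('a::order, 'a \<times> 'a) pre_digraph"
  where "hasse_diagram = \<lparr>verts = UNIV, arcs = {(x, y). x \<lessdot> y}, tail = fst, head = snd\<rparr>"

definition rank_connected :: "'a::{finite, bounded_lattice} itself \<Rightarrow> bool"
  where "rank_connected L \<longleftrightarrow> ranked L \<and>
    (\<forall>i < rank (top :: 'a).
      Digraph_Component.connected
        (hasse_diagram \<restriction> (rank_level i \<union> rank_level (Suc i) :: 'a set)))"

definition sublattice :: "'a::lattice set \<Rightarrow> bool"
  where "sublattice S \<longleftrightarrow> S \<noteq> {} \<and> (\<forall>x\<in>S. \<forall>y\<in>S. inf x y \<in> S \<and> sup x y \<in> S)"

definition dismantlable :: "'a::{finite, bounded_lattice} itself \<Rightarrow> bool"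
  where "dismantlable L \<longleftrightarrow>
    (\<exists>S :: nat \<Rightarrow> 'a set.
      (\<forall>i \<in> {1..CARD('a)}. sublattice (S i) \<and> card (S i) = i) \<and>
      (\<forall>i \<in> {1..<CARD('a)}. S i \<subseteq> S (Suc i)) \<and>
      S CARD('a) = UNIV)"

definition unrefinable_chain :: "'a::order \<Rightarrow> 'a \<Rightarrow> 'a list \<Rightarrow> bool"
  where "unrefinable_chain x y xs \<longleftrightarrow>
    xs \<noteq> [] \<and> hd xs = x \<and> last xs = y \<and> successively (\<lessdot>) xs"

definition rising_chain :: "('a::order \<Rightarrow> 'a \<Rightarrow> real) \<Rightarrow> 'a \<Rightarrow> 'a \<Rightarrow> 'a list \<Rightarrow> bool"
  where "rising_chain f x y xs \<longleftrightarrow> unrefinable_chain x y xs \<and> sorted (map2 f xs (tl xs))"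

text \<open>
  A labeling is total on pairs, but only its values at covering pairs are ever used. If \<open>x = y\<close>,
  the rising chain is \<open>[x]\<close> and the second condition is vacuous, so \<open>xs ! 1\<close> is only used where
  it exists.
\<close>

definition lexicographically_shellable :: "'a::{finite, bounded_lattice} itself \<Rightarrow> bool"
  where "lexicographically_shellable L \<longleftrightarrow> ranked L \<and>
    (\<exists>f :: 'a \<Rightarrow> 'a \<Rightarrow> real.
      (\<forall>x y. x \<le> y \<longrightarrow> (\<exists>!xs. rising_chain f x y xs)) \<and>
      (\<forall>x y xs z. x \<le> y \<longrightarrow> rising_chain f x y xs \<longrightarrow> z \<in> {x..y} \<longrightarrow> x \<lessdot> z \<longrightarrow> z \<noteq> xs ! 1 \<longrightarrow>
        f x (xs ! 1) < f x z))"

end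

theory Submission
  imports Defs
begin

text \<open>
  The labeling is built along the chain of sublattices, one new element \<open>x\<close> at a time. Let \<open>a\<close> and
  \<open>b\<close> be the lower and the upper cover of \<open>x\<close>. If \<open>a\<close> and \<open>b\<close> are still not a covering pair after
  the removal of \<open>x\<close>, label the edge below \<open>x\<close> by a large \<open>M\<close> and the edge above \<open>x\<close> by \<open>- M\<close>: a
  chain through \<open>x\<close> then has a descent at \<open>x\<close>, and \<open>x\<close> is never the first step of a rising chain
  from \<open>a\<close> past \<open>x\<close>. If \<open>a\<close> and \<open>b\<close> do become a covering pair, then \<open>x\<close> must be alone in its rank
  level, since otherwise connectedness of the levels would produce a cycle, which cannot occur in a
  dismantlable lattice. So all elements are comparable to \<open>x\<close>, and it suffices to shift the labels
  above \<open>x\<close> past those below it.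
\<close>

section \<open>Labelings on the intervals of a subset\<close>

text \<open>Covering is relative to \<open>S\<close>: the sublattices of the induction have covers
  of their own, and these may be destroyed when an element is inserted.\<close>

definition covers_in :: "'a::order set \<Rightarrow> 'a \<Rightarrow> 'a \<Rightarrow> bool"
  where "covers_in S x y \<longleftrightarrow> x \<in> S \<and> y \<in> S \<and> x < y \<and> \<not> (\<exists>z\<in>S. x < z \<and> z < y)"

definition chain_in :: "'a::order set \<Rightarrow> 'a \<Rightarrow> 'a \<Rightarrow> 'a list \<Rightarrow> bool"
  where "chain_in S x y xs \<longleftrightarrow>
    xs \<noteq> [] \<and> set xs \<subseteq> S \<and> hd xs = x \<and> last xs = y \<and> successively (covers_in S) xs"

definition labels :: "('a \<Rightarrow> 'a \<Rightarrow> 'b) \<Rightarrow> 'a list \<Rightarrow> 'b list"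
  where "labels f xs = map2 f xs (tl xs)"

definition rising_in :: "'a::order set \<Rightarrow> ('a \<Rightarrow> 'a \<Rightarrow> real) \<Rightarrow> 'a \<Rightarrow> 'a \<Rightarrow> 'a list \<Rightarrow> bool"
  where "rising_in S f x y xs \<longleftrightarrow> chain_in S x y xs \<and> sorted (labels f xs)"

text \<open>Both labeling conditions for a single interval. Isolating one interval allows a labeling
  of a larger set to be checked by transferring known intervals and gluing them at
  cutpoints.\<close>

definition el_interval :: "'a::order set \<Rightarrow> ('a \<Rightarrow> 'a \<Rightarrow> real) \<Rightarrow> 'a \<Rightarrow> 'a \<Rightarrow> bool"
  where "el_interval S f x y \<longleftrightarrow> (\<exists>!xs. rising_in S f x y xs) \<and>
    (\<forall>xs z. rising_in S f x y xs \<longrightarrow> z \<le> y \<longrightarrow> covers_in S x z \<longrightarrow> z \<noteq> xs ! 1 \<longrightarrow>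
      f x (xs ! 1) < f x z)"

definition el_labeling :: "'a::order set \<Rightarrow> ('a \<Rightarrow> 'a \<Rightarrow> real) \<Rightarrow> bool"
  where "el_labeling S f \<longleftrightarrow> (\<forall>x\<in>S. \<forall>y\<in>S. x \<le> y \<longrightarrow> el_interval S f x y)"

section \<open>Chains and their labels\<close>

lemma covers_inD:
  assumes "covers_in S x y"
  shows "x \<in> S" "y \<in> S" "x < y" "\<And>z. z \<in> S \<Longrightarrow> x < z \<Longrightarrow> \<not> z < y"
  using assms by (auto simp: covers_in_def)

lemma chain_in_Cons:
  "chain_in S x y (z # xs) \<longleftrightarrow> z = x \<and> x \<in> S \<and>
    (xs = [] \<and> x = y \<or> xs \<noteq> [] \<and> covers_in S x (hd xs) \<and> chain_in S (hd xs) y xs)"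
  by (auto simp: chain_in_def successively_Cons)

lemma chain_in_le:
  "chain_in S x y xs \<Longrightarrow> z \<in> set xs \<Longrightarrow> x \<le> z \<and> z \<le> y"
proof (induction xs arbitrary: x z)
  case Nil
  then show ?case by simp
next
  case (Cons w xs)
  show ?case
  proof (cases "xs = []")
    case True
    with Cons.prems show ?thesis by (auto simp: chain_in_Cons)
  next
    case False
    with Cons.prems(1) have c: "w = x" "x < hd xs" "chain_in S (hd xs) y xs"
      by (auto simp: chain_in_Cons covers_in_def)
    have "w' \<in> set xs \<Longrightarrow> hd xs \<le> w' \<and> w' \<le> y" for w'
      using Cons.IH[OF c(3)] by blast
    with c Cons.prems(2) False show ?thesis
      by (metis hd_in_set less_imp_le order_refl order_trans set_ConsD)
  qed
qed

lemma chain_in_ends: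
  assumes "chain_in S x y xs"
  shows "x \<in> set xs" "y \<in> set xs" "x \<le> y" "x \<in> S" "y \<in> S"
proof -
  show *: "x \<in> set xs" "y \<in> set xs"
    using assms by (auto simp: chain_in_def)
  show "x \<le> y" using chain_in_le[OF assms *(1)] by simp
  show "x \<in> S" "y \<in> S" using * assms by (auto simp: chain_in_def)
qed

lemma chain_in_append:
  "chain_in S x y (ys @ c # zs) \<longleftrightarrow> chain_in S x c (ys @ [c]) \<and> chain_in S c y (c # zs)"
  by (auto simp: chain_in_def successively_append_iff hd_append successively_Cons)

lemma labels_append:
  "labels f (ys @ c # zs) = labels f (ys @ [c]) @ labels f (c # zs)"
proof (induction ys)
  case Nil
  then show ?case by (simp add: labels_def)
next
  case (Cons a ys)
  then show ?case by (cases ys) (auto simp: labels_def)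
qed

lemma labels_bounds:
  "chain_in S x y xs \<Longrightarrow> l \<in> set (labels f xs) \<Longrightarrow>
    \<exists>p q. covers_in S p q \<and> x \<le> p \<and> q \<le> y \<and> l = f p q"
proof (induction xs arbitrary: x)
  case Nil
  then show ?case by (simp add: labels_def)
next
  case (Cons w xs)
  show ?case
  proof (cases xs)
    case Nil
    with Cons.prems show ?thesis by (simp add: labels_def)
  next
    case (Cons v vs)
    with Cons.prems(1) have c: "w = x" "covers_in S x v" "chain_in S v y xs"
      by (auto simp: chain_in_Cons)
    from Cons.prems(2) Cons have "l = f w v \<or> l \<in> set (labels f xs)"
      by (auto simp: labels_def)
    then show ?thesis
    proof
      assume "l = f w v"
      with c chain_in_ends(3)[OF c(3)] show ?thesis by blast
    next
      assume "l \<in> set (labels f xs)"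
      from Cons.IH[OF c(3) this] obtain p q
        where "covers_in S p q" "v \<le> p" "q \<le> y" "l = f p q" by blast
      moreover from this covers_inD(3)[OF c(2)] have "x \<le> p" by simp
      ultimately show ?thesis by blast
    qed
  qed
qed

text \<open>A step of the chain that starts below \<open>c\<close> cannot jump over it: its end is
  comparable to \<open>c\<close>, and \<open>c\<close> cannot lie strictly inside a covering
  pair.\<close>

lemma cutpoint_in_chain:
  "chain_in S x y xs \<Longrightarrow> c \<in> S \<Longrightarrow> x \<le> c \<Longrightarrow> c \<le> y \<Longrightarrow>
    (\<And>s. s \<in> S \<Longrightarrow> x \<le> s \<Longrightarrow> s \<le> y \<Longrightarrow> s \<le> c \<or> c \<le> s) \<Longrightarrow> c \<in> set xs"
proof (induction xs arbitrary: x)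
  case Nil
  then show ?case by (simp add: chain_in_def)
next
  case (Cons w xs)
  show ?case
  proof (cases xs)
    case Nil
    with Cons.prems show ?thesis by (auto simp: chain_in_Cons)
  next
    case (Cons v vs)
    with Cons.prems(1) have c: "w = x" "covers_in S x v" "chain_in S v y xs"
      by (auto simp: chain_in_Cons)
    note v = covers_inD[OF c(2)] chain_in_ends[OF c(3)]
    show ?thesis
    proof (cases "x = c")
      case False
      with Cons.prems(3) have "x < c" by simp
      with v(4)[OF Cons.prems(2)] Cons.prems(5)[of v] v have "v \<le> c"
        by (metis less_imp_le order_le_less)
      moreover have "s \<le> c \<or> c \<le> s" if "s \<in> S" "v \<le> s" "s \<le> y" for s
        using Cons.prems(5)[of s] that v(3) by auto
      ultimately have "c \<in> set xs"
        using Cons.IH[OF c(3) Cons.prems(2)] Cons.prems(4) by blast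
      then show ?thesis by simp
    qed (use c in simp)
  qed
qed

lemma labels_map:
  assumes "chain_in S x y xs"
    and "\<And>p q. covers_in S p q \<Longrightarrow> x \<le> p \<Longrightarrow> q \<le> y \<Longrightarrow> g p q = h (f p q)"
  shows "labels g xs = map h (labels f xs)"
  using assms
proof (induction xs arbitrary: x)
  case Nil
  then show ?case by (simp add: labels_def)
next
  case (Cons w xs)
  show ?case
  proof (cases xs)
    case Nil
    then show ?thesis by (simp add: labels_def)
  next
    case (Cons v vs)
    with Cons.prems(1) have c: "w = x" "covers_in S x v" "chain_in S v y xs"
      by (auto simp: chain_in_Cons)
    have "labels g xs = map h (labels f xs)"
      using Cons.IH[OF c(3)] Cons.prems(2) covers_inD(3)[OF c(2)]
      by (meson less_imp_le order_trans)
    moreover have "g w v = h (f w v)"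
      using Cons.prems(2) c chain_in_ends(3)[OF c(3)] by simp
    ultimately show ?thesis using Cons by (simp add: labels_def)
  qed
qed

lemma covers_in_cong:
  assumes "S \<inter> {x..y} = T \<inter> {x..y}" "x \<le> p" "q \<le> y"
  shows "covers_in S p q \<longleftrightarrow> covers_in T p q"
proof -
  have "s \<in> S \<longleftrightarrow> s \<in> T" if "x \<le> s" "s \<le> y" for s
    using assms(1) that by (metis IntI IntD1 atLeastAtMost_iff)
  moreover have "x \<le> z \<and> z \<le> y" if "p \<le> z" "z \<le> q" for z
    using assms that by (meson order_trans)
  ultimately show ?thesis
    unfolding covers_in_def by (metis less_imp_le order_refl)
qed

lemma chain_in_mono:
  assumes "chain_in S x y xs" and "set xs \<subseteq> T"
    and "\<And>p q. covers_in S p q \<Longrightarrow> p \<in> set xs \<Longrightarrow> q \<in> set xs \<Longrightarrow> covers_in T p q"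
  shows "chain_in T x y xs"
  using assms successively_mono[of "covers_in S" xs "covers_in T"] unfolding chain_in_def by blast

lemma chain_in_cong:
  assumes "S \<inter> {x..y} = T \<inter> {x..y}"
  shows "chain_in S x y xs \<longleftrightarrow> chain_in T x y xs"
proof -
  have "chain_in T x y xs" if "chain_in S x y xs" "S \<inter> {x..y} = T \<inter> {x..y}" for S T :: "'a set"
  proof (rule chain_in_mono[OF that(1)])
    show "set xs \<subseteq> T"
      using that chain_in_le[OF that(1)] unfolding chain_in_def by fastforce
    show "covers_in T p q" if "covers_in S p q" "p \<in> set xs" "q \<in> set xs" for p q
      using covers_in_cong[OF \<open>S \<inter> {x..y} = T \<inter> {x..y}\<close>] chain_in_le[OF \<open>chain_in S x y xs\<close>] that
      by blast
  qed
  from this[of S T] this[of T S] assms show ?thesis by auto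
qed

lemma chain_in_1:
  assumes "chain_in S x y xs" "x < y"
  shows "covers_in S x (xs ! 1)" "xs ! 1 \<le> y" "1 < length xs"
proof -
  from assms obtain v vs where "xs = x # v # vs"
    by (metis chain_in_Cons chain_in_def less_irrefl neq_Nil_conv)
  moreover from this assms(1) have "covers_in S x v" "chain_in S v y (v # vs)"
    by (auto simp: chain_in_Cons)
  ultimately show "covers_in S x (xs ! 1)" "xs ! 1 \<le> y" "1 < length xs"
    using chain_in_ends(3) by auto
qed

text \<open>Adding a constant to all labels changes no comparison between them. With
  \<open>k = 0\<close> this transfers an interval between two sets that agree on it.\<close>

lemma el_interval_shift:
  assumes el: "el_interval S f x y" and ST: "S \<inter> {x..y} = T \<inter> {x..y}"
    and g: "\<And>p q. covers_in S p q \<Longrightarrow> x \<le> p \<Longrightarrow> q \<le> y \<Longrightarrow> g p q = f p q + k"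
  shows "el_interval T g x y"
proof -
  have r: "rising_in T g x y xs \<longleftrightarrow> rising_in S f x y xs" for xs
  proof -
    have "sorted (map (\<lambda>l. l + k) ls) \<longleftrightarrow> sorted ls" for ls :: "real list"
      by (auto simp: sorted_iff_nth_mono)
    with labels_map[of S x y xs g "\<lambda>l. l + k" f] g chain_in_cong[OF ST, of xs]
    show ?thesis unfolding rising_in_def by auto
  qed
  show ?thesis
    unfolding el_interval_def r
  proof (intro conjI allI impI)
    show "\<exists>!xs. rising_in S f x y xs" using el by (simp add: el_interval_def)
    fix xs z
    assume xs: "rising_in S f x y xs" and z: "z \<le> y" "covers_in T x z" "z \<noteq> xs ! 1"
    have "covers_in S x z" using covers_in_cong[OF ST] z by blast
    with el xs z have "f x (xs ! 1) < f x z" unfolding el_interval_def by blast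
    moreover have "covers_in S x (xs ! 1)" "xs ! 1 \<le> y"
      using chain_in_1[of S x y xs] xs z covers_inD(3)[OF z(2)] by (auto simp: rising_in_def)
    ultimately show "g x (xs ! 1) < g x z"
      using g \<open>covers_in S x z\<close> z by simp
  qed
qed

lemma el_interval_refl:
  assumes "x \<in> S"
  shows "el_interval S f x x"
proof -
  have "rising_in S f x x xs \<longleftrightarrow> xs = [x]" for xs
  proof
    assume "rising_in S f x x xs"
    then have c: "chain_in S x x xs" by (simp add: rising_in_def)
    then obtain ys where "xs = x # ys" by (cases xs) (auto simp: chain_in_def)
    moreover have "ys = []"
    proof (rule ccontr)
      assume "ys \<noteq> []"
      with c \<open>xs = x # ys\<close> have "covers_in S x (hd ys)" "chain_in S (hd ys) x ys"
        by (auto simp: chain_in_Cons)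
      then show False using covers_inD(3) chain_in_ends(3) by (metis less_le_not_le)
    qed
    ultimately show "xs = [x]" by simp
  qed (use assms in \<open>simp add: rising_in_def chain_in_def labels_def\<close>)
  then show ?thesis
    unfolding el_interval_def using covers_inD(3) by (metis less_le_not_le)
qed

lemma el_interval_cover:
  assumes "covers_in S x y"
  shows "el_interval S f x y"
proof -
  note c = covers_inD[OF assms]
  have "rising_in S f x y xs \<longleftrightarrow> xs = [x, y]" for xs
  proof
    assume "rising_in S f x y xs"
    then have "chain_in S x y xs" by (simp add: rising_in_def)
    with c obtain v vs where "xs = x # v # vs"
      by (metis chain_in_Cons chain_in_def less_irrefl neq_Nil_conv)
    with \<open>chain_in S x y xs\<close> have v: "covers_in S x v" "chain_in S v y (v # vs)"
      by (auto simp: chain_in_Cons)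
    with c have "v = y" using covers_inD[OF v(1)] chain_in_ends(3)[OF v(2)] by fastforce
    with v(2) have "vs = []"
      by (metis chain_in_Cons chain_in_ends(3) covers_inD(3) less_le_not_le)
    with \<open>v = y\<close> \<open>xs = x # v # vs\<close> show "xs = [x, y]" by simp
  qed (use assms c in \<open>simp add: rising_in_def chain_in_def labels_def\<close>)
  moreover have "z = y" if "covers_in S x z" "z \<le> y" for z
    using covers_inD[OF that(1)] c that by fastforce
  ultimately show ?thesis
    unfolding el_interval_def by fastforce
qed

text \<open>Every unrefinable chain from \<open>x\<close> to \<open>y\<close> passes through the
  cutpoint \<open>c\<close>, and labels below \<open>c\<close> never exceed labels above it. Hence
  the rising chains are exactly the concatenations of a rising chain up to \<open>c\<close> and one
  from \<open>c\<close>.\<close>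

lemma el_interval_glue:
  assumes el: "el_interval S f x c" "el_interval S f c y"
    and c: "x \<le> c" "c \<le> y" "c \<in> S"
    and comparable: "\<And>s. s \<in> S \<Longrightarrow> x \<le> s \<Longrightarrow> s \<le> y \<Longrightarrow> s \<le> c \<or> c \<le> s"
    and mono: "\<And>p q p' q'. covers_in S p q \<Longrightarrow> x \<le> p \<Longrightarrow> q \<le> c \<Longrightarrow>
      covers_in S p' q' \<Longrightarrow> c \<le> p' \<Longrightarrow> q' \<le> y \<Longrightarrow> f p q \<le> f p' q'"
  shows "el_interval S f x y"
proof (cases "x = c")
  case True
  with el show ?thesis by simp
next
  case False
  with c have "x < c" by simp
  have split: "rising_in S f x y (ys @ c # zs) \<longleftrightarrow>
      rising_in S f x c (ys @ [c]) \<and> rising_in S f c y (c # zs)" for ys zs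
  proof -
    have "l \<le> l'" if "chain_in S x c (ys @ [c])" "chain_in S c y (c # zs)"
      "l \<in> set (labels f (ys @ [c]))" "l' \<in> set (labels f (c # zs))" for l l'
      using labels_bounds[OF that(1,3)] labels_bounds[OF that(2,4)] mono by metis
    then show ?thesis
      using chain_in_append[of S x y ys c zs] labels_append[of f ys c zs]
      by (auto simp: rising_in_def sorted_append)
  qed
  have cut: "\<exists>ys zs. xs = ys @ c # zs" if "rising_in S f x y xs" for xs
  proof -
    have "chain_in S x y xs" using that by (simp add: rising_in_def)
    then have "c \<in> set xs" using cutpoint_in_chain c comparable by blast
    then show ?thesis by (rule split_list)
  qed
  have form1: "\<exists>ys. xs = ys @ [c]" if "rising_in S f x c xs" for xs
    using that by (auto simp: chain_in_def rising_in_def intro!: exI[of _ "butlast xs"])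
  have form2: "\<exists>zs. xs = c # zs" if "rising_in S f c y xs" for xs
    using that by (cases xs) (auto simp: chain_in_def rising_in_def)
  obtain ys' zs' where r': "rising_in S f x c ys'" "rising_in S f c y zs'"
    using el unfolding el_interval_def by blast
  from form1[OF r'(1)] form2[OF r'(2)] r' obtain ys zs
    where r: "rising_in S f x c (ys @ [c])" "rising_in S f c y (c # zs)" by blast
  have uniq: "xs = ys @ c # zs" if xs: "rising_in S f x y xs" for xs
  proof -
    from cut[OF xs] obtain ys' zs' where "xs = ys' @ c # zs'" by blast
    with xs split have "rising_in S f x c (ys' @ [c])" "rising_in S f c y (c # zs')" by auto
    with r el have "ys' @ [c] = ys @ [c]" "c # zs' = c # zs"
      unfolding el_interval_def by blast+
    with \<open>xs = ys' @ c # zs'\<close> show ?thesis by simp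
  qed
  \<comment> \<open>Since \<open>x < c\<close>, the lower part has at least two members, so it
    already contains the second member of the whole chain.\<close>
  have one: "(ys @ c # zs) ! 1 = (ys @ [c]) ! 1"
    using chain_in_1(3)[of S x c "ys @ [c]"] r \<open>x < c\<close>
    by (cases ys; cases "tl ys") (auto simp: rising_in_def nth_append)
  show ?thesis
    unfolding el_interval_def
  proof (intro conjI allI impI)
    show "\<exists>!xs. rising_in S f x y xs"
    proof (rule ex1I)
      show "rising_in S f x y (ys @ c # zs)" using split r by simp
    qed (rule uniq)
    fix xs z
    assume xs: "rising_in S f x y xs" and z: "z \<le> y" "covers_in S x z" "z \<noteq> xs ! 1"
    \<comment> \<open>If instead \<open>c \<le> z\<close>, then \<open>x < c \<le> z\<close>, and
      the cover forces \<open>z = c\<close>. So the first-step condition only concerns the lower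
      interval.\<close>
    have "z \<le> c"
      using comparable[of z] covers_inD[OF z(2)] z(1) c(3) \<open>x < c\<close>
      by (metis less_imp_le order_le_less)
    moreover have "xs ! 1 = (ys @ [c]) ! 1" using one uniq[OF xs] by simp
    ultimately show "f x (xs ! 1) < f x z"
      using el(1) r(1) z unfolding el_interval_def by simp
  qed
qed

section \<open>Extending a labeling by one new element\<close>

lemma finite_abs_bound:
  fixes f :: "'a::finite \<Rightarrow> 'b::finite \<Rightarrow> real"
  obtains M where "\<And>u v. \<bar>f u v\<bar> < M"
proof
  show "\<bar>f u v\<bar> < Max (range (\<lambda>(u, v). \<bar>f u v\<bar>)) + 1" for u v
  proof -
    have "\<bar>f u v\<bar> \<in> range (\<lambda>(u, v). \<bar>f u v\<bar>)" by force
    then show ?thesis using Max_ge[of "range (\<lambda>(u, v). \<bar>f u v\<bar>)"] by fastforce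
  qed
qed

lemma covers_in_insert:
  assumes "\<And>u v. covers_in T u v \<Longrightarrow> \<not> (u < x \<and> x < v)" "p \<in> T" "q \<in> T"
  shows "covers_in (insert x T) p q \<longleftrightarrow> covers_in T p q"
  using assms unfolding covers_in_def by blast

text \<open>The case in which no covering pair of \<open>T\<close> is separated by \<open>x\<close>,
  so that all old covers persist. The neighbours of \<open>x\<close> are assumed conditionally
  because \<open>x\<close> may become the least or the greatest element.\<close>

lemma el_labeling_insert:
  fixes T :: "'a::{finite, order} set"
  assumes el: "el_labeling T f" and x: "x \<notin> T"
    and lower: "\<And>t. t \<in> T \<Longrightarrow> t < x \<Longrightarrow> \<exists>a\<in>T. a < x \<and> (\<forall>s\<in>T. s < x \<longrightarrow> s \<le> a)"
    and upper: "\<And>t. t \<in> T \<Longrightarrow> x < t \<Longrightarrow> \<exists>b\<in>T. x < b \<and> (\<forall>s\<in>T. x < s \<longrightarrow> b \<le> s)"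
    and cov: "\<And>u v. covers_in T u v \<Longrightarrow> \<not> (u < x \<and> x < v)"
  shows "\<exists>g. el_labeling (insert x T) g"
proof -
  obtain M where M: "\<bar>f u v\<bar> < M" for u v
    using finite_abs_bound[of f] by blast
  define S where "S = insert x T"
  define g where "g = (\<lambda>u v. if v = x then M else if u = x then - M else f u v)"
  have g_x: "g u x = M" for u by (simp add: g_def)
  have g_x': "v \<noteq> x \<Longrightarrow> g x v = - M" for v by (simp add: g_def)
  have g_f: "u \<noteq> x \<Longrightarrow> v \<noteq> x \<Longrightarrow> g u v = f u v" for u v by (simp add: g_def)
  have g_le: "g u v \<le> M" and g_ge: "v \<noteq> x \<Longrightarrow> - M \<le> g u v" for u v
    using M[of u v] by (auto simp: g_def)
  have covS: "covers_in S p q \<longleftrightarrow> covers_in T p q" if "p \<in> T" "q \<in> T" for p q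
    unfolding S_def using cov that by (rule covers_in_insert)
  \<comment> \<open>An interval that does not straddle \<open>x\<close> does not contain
    \<open>x\<close>, and its labels are unchanged.\<close>
  have away: "el_interval S g u v" if "u \<in> T" "v \<in> T" "u \<le> v" "\<not> (u < x \<and> x < v)" for u v
  proof (rule el_interval_shift[where T = S and k = 0])
    show "el_interval T f u v" using el that by (auto simp: el_labeling_def)
    show "T \<inter> {u..v} = S \<inter> {u..v}" using that x by (auto simp: S_def order_le_less)
    show "g p q = f p q + 0" if "covers_in T p q" for p q
      using covers_inD[OF that] x g_f by fastforce
  qed
  have across: "el_interval S g u v" if uv: "u \<in> T" "v \<in> T" "u \<le> v" for u v
  proof (cases "u < x \<and> x < v")
    case False
    with uv away show ?thesis by blast
  next
    case True
    \<comment> \<open>Across \<open>x\<close> the rising chains are the old ones: \<open>x\<close>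
      is not an end of the chain, so a chain through it carries \<open>M\<close> directly followed
      by \<open>- M\<close>, a descent because \<open>M > 0\<close>.\<close>
    have eq: "rising_in S g u v xs \<longleftrightarrow> rising_in T f u v xs" for xs
    proof -
      have lab: "labels g xs = labels f xs" if "x \<notin> set xs"
      proof -
        have "p \<noteq> x \<and> q \<noteq> x" if "(p, q) \<in> set (zip xs (tl xs))" for p q
          using set_zip_leftD[OF that] set_zip_rightD[OF that] \<open>x \<notin> set xs\<close>
          by (auto dest: list.set_sel(2)[rotated] simp: tl_def split: list.splits)
        then show ?thesis unfolding labels_def by (auto simp: g_f)
      qed
      show ?thesis
      proof
        assume r: "rising_in S g u v xs"
        then have c: "chain_in S u v xs" and sorted: "sorted (labels g xs)"
          by (auto simp: rising_in_def)
        have "x \<notin> set xs"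
        proof
          assume "x \<in> set xs"
          then obtain ys zs where xs: "xs = ys @ x # zs" by (meson split_list)
          with c True have "ys \<noteq> []" "zs \<noteq> []" by (auto simp: chain_in_def)
          then obtain ys' p q zs' where "ys = ys' @ [p]" "zs = q # zs'"
            by (metis neq_Nil_conv rev_exhaust)
          with xs have "xs = ys' @ p # x # q # zs'" by simp
          then have "labels g xs = labels g (ys' @ [p]) @ g p x # g x q # labels g (q # zs')"
            using labels_append[of g ys' p "x # q # zs'"] by (simp add: labels_def)
          moreover have "covers_in S x q"
            using c \<open>xs = ys' @ p # x # q # zs'\<close>
            by (simp add: chain_in_def successively_append_iff)
          ultimately show False
            using sorted M[of x x] covers_inD(3) g_x[of p] g_x'[of q]
            by (force simp: sorted_append)
        qed
        moreover have "chain_in T u v xs"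
        proof (rule chain_in_mono[OF c])
          show "set xs \<subseteq> T" using c \<open>x \<notin> set xs\<close> by (auto simp: chain_in_def S_def)
          then show "covers_in T p q" if "covers_in S p q" "p \<in> set xs" "q \<in> set xs" for p q
            using that covS by blast
        qed
        ultimately show "rising_in T f u v xs" using sorted lab by (simp add: rising_in_def)
      next
        assume r: "rising_in T f u v xs"
        then have c: "chain_in T u v xs" by (simp add: rising_in_def)
        then have "set xs \<subseteq> T" by (simp add: chain_in_def)
        have "chain_in S u v xs"
          using chain_in_mono[OF c, of S] covS \<open>set xs \<subseteq> T\<close> by (auto simp: S_def)
        moreover have "labels g xs = labels f xs" using lab \<open>set xs \<subseteq> T\<close> x by blast
        ultimately show "rising_in S g u v xs" using r by (simp add: rising_in_def)
      qed
    qed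
    have el': "el_interval T f u v" using el uv True by (force simp: el_labeling_def)
    show ?thesis
      unfolding el_interval_def eq
    proof (intro conjI allI impI)
      show "\<exists>!xs. rising_in T f u v xs" using el' by (simp add: el_interval_def)
      fix xs z
      assume xs: "rising_in T f u v xs" and z: "z \<le> v" "covers_in S u z" "z \<noteq> xs ! 1"
      have "covers_in T u (xs ! 1)"
        using chain_in_1(1)[of T u v xs] xs True by (auto simp: rising_in_def)
      then have "xs ! 1 \<noteq> x" using x by (auto simp: covers_in_def)
      then have *: "g u (xs ! 1) = f u (xs ! 1)" using g_f[of u] True by auto
      \<comment> \<open>The only possible new first step is \<open>x\<close> itself, and its label
        \<open>M\<close> exceeds every old label.\<close>
      show "g u (xs ! 1) < g u z"
      proof (cases "z = x")
        case True
        then show ?thesis using * g_x M[of u "xs ! 1"] by simp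
      next
        case False
        with z(2) uv have "covers_in T u z" using covS by (auto simp: S_def dest: covers_inD)
        with el' xs z have "f u (xs ! 1) < f u z" by (auto simp: el_interval_def)
        moreover have "g u z = f u z" using g_f False \<open>u < x \<and> x < v\<close> by auto
        ultimately show ?thesis using * by simp
      qed
    qed
  qed
  \<comment> \<open>All of the interval except \<open>x\<close> lies below the lower neighbour
    \<open>a\<close>, and the last edge has the largest label \<open>M\<close>; so \<open>a\<close>
    serves as the cutpoint.\<close>
  have below: "el_interval S g u x" if u: "u \<in> T" "u < x" for u
  proof -
    from lower[OF u] obtain a where a: "a \<in> T" "a < x" "\<And>s. s \<in> T \<Longrightarrow> s < x \<Longrightarrow> s \<le> a"
      by blast
    have below_x: "s = x \<or> s \<le> a" if "s \<in> S" "s \<le> x" for s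
      using that a(3)[of s] by (auto simp: S_def less_le)
    show ?thesis
    proof (rule el_interval_glue)
      show "el_interval S g u a" using across u a by blast
      show "el_interval S g a x"
        using a below_x by (intro el_interval_cover) (fastforce simp: covers_in_def S_def)
      show "g p q \<le> g p' q'" if "covers_in S p' q'" "a \<le> p'" "q' \<le> x" for p q p' q'
      proof -
        have "q' = x" using below_x[of q'] covers_inD(2,3)[OF that(1)] that by auto
        then show ?thesis using g_le g_x by simp
      qed
      show "s \<le> a \<or> a \<le> s" if "s \<in> S" "s \<le> x" for s
        using below_x[OF that] a by auto
    qed (use a u in \<open>auto simp: S_def\<close>)
  qed
  \<comment> \<open>Dually, the first edge has the smallest label \<open>- M\<close>, and the upper
    neighbour \<open>b\<close> serves as the cutpoint.\<close>
  have above: "el_interval S g x v" if v: "v \<in> T" "x < v" for v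
  proof -
    from upper[OF v] obtain b where b: "b \<in> T" "x < b" "\<And>s. s \<in> T \<Longrightarrow> x < s \<Longrightarrow> b \<le> s"
      by blast
    have above_x: "s = x \<or> b \<le> s" if "s \<in> S" "x \<le> s" for s
      using that b(3)[of s] by (auto simp: S_def less_le)
    show ?thesis
    proof (rule el_interval_glue)
      show "el_interval S g b v" using across v b by blast
      show "el_interval S g x b"
        using b above_x by (intro el_interval_cover) (fastforce simp: covers_in_def S_def)
      show "g p q \<le> g p' q'"
        if "covers_in S p q" "x \<le> p" "q \<le> b" "covers_in S p' q'" "b \<le> p'" for p q p' q'
      proof -
        have "p = x" using above_x[of p] covers_inD(1,3)[OF that(1)] that by auto
        moreover have "q \<noteq> x" "q' \<noteq> x"
          using covers_inD(3)[OF that(1)] covers_inD(3)[OF that(4)] that b(2) by auto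
        ultimately show ?thesis using g_ge g_x' by simp
      qed
      show "s \<le> b \<or> b \<le> s" if "s \<in> S" "x \<le> s" for s
        using above_x[OF that] b by auto
    qed (use b v in \<open>auto simp: S_def\<close>)
  qed
  have "el_labeling S g"
    unfolding el_labeling_def
    using across below above el_interval_refl[of x S g] by (auto simp: S_def order_le_less)
  then show ?thesis unfolding S_def by blast
qed

text \<open>After the insertion every element is comparable to each of \<open>a\<close>,
  \<open>x\<close> and \<open>b\<close>, so the intervals that meet \<open>x\<close> arise by gluing
  at these three. The old label of \<open>(a, b)\<close> disappears, since this is no longer a
  covering pair.\<close>

lemma el_labeling_insert_between:
  fixes T :: "'a::{finite, order} set"
  assumes el: "el_labeling T f" and x: "x \<notin> T"
    and ab: "a \<in> T" "b \<in> T" "a < x" "x < b"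
    and comparable: "\<And>t. t \<in> T \<Longrightarrow> t \<le> a \<or> b \<le> t"
  shows "\<exists>g. el_labeling (insert x T) g"
proof -
  obtain M where M: "\<bar>f u v\<bar> < M" for u v
    using finite_abs_bound[of f] by blast
  define S where "S = insert x T"
  \<comment> \<open>Old labels lie strictly between \<open>- M\<close> and \<open>M\<close>. The
    shift by \<open>2 * M\<close> lifts those from \<open>b\<close> upwards above \<open>M\<close>,
    which leaves \<open>M\<close> for the two edges at \<open>x\<close>.\<close>
  define g where
    "g = (\<lambda>u v. if u = x \<or> v = x then M else if b \<le> u then f u v + 2 * M else f u v)"
  have g_le: "g p q \<le> M" if "covers_in S p q" "q \<le> x" for p q
    using covers_inD(3)[OF that(1)] that(2) ab M[of p q] by (auto simp: g_def)
  have g_ge: "M \<le> g p q" if "covers_in S p q" "x \<le> p" for p q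
  proof -
    have "p = x \<or> b \<le> p"
      using covers_inD(1)[OF that(1)] that(2) ab comparable[of p] by (auto simp: S_def)
    then show ?thesis using M[of p q] by (auto simp: g_def)
  qed
  have below_x: "s = x \<or> s \<le> a" if "s \<in> S" "s \<le> x" for s
    using that comparable[of s] ab by (auto simp: S_def)
  have above_x: "s = x \<or> b \<le> s" if "s \<in> S" "x \<le> s" for s
    using that comparable[of s] ab by (auto simp: S_def)
  have in_S: "a \<in> S" "b \<in> S" "x \<in> S" using ab by (auto simp: S_def)
  have cov_ax: "covers_in S a x" and cov_xb: "covers_in S x b"
    using ab comparable by (force simp: covers_in_def S_def)+
  have lower: "el_interval S g u v" if "u \<in> T" "u \<le> v" "v \<in> T" "v \<le> a" for u v
  proof (rule el_interval_shift[where T = S and k = 0])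
    show "el_interval T f u v" using el that by (auto simp: el_labeling_def)
    show "T \<inter> {u..v} = S \<inter> {u..v}" using that ab by (auto simp: S_def)
    show "g p q = f p q + 0" if "covers_in T p q" "u \<le> p" "q \<le> v" for p q
      using covers_inD[OF that(1)] that \<open>v \<le> a\<close> x ab by (auto simp: g_def)
  qed
  have upper: "el_interval S g u v" if "u \<in> T" "u \<le> v" "v \<in> T" "b \<le> u" for u v
  proof (rule el_interval_shift[where T = S and k = "2 * M"])
    show "el_interval T f u v" using el that by (auto simp: el_labeling_def)
    show "T \<inter> {u..v} = S \<inter> {u..v}" using that ab by (auto simp: S_def)
    show "g p q = f p q + 2 * M" if "covers_in T p q" "u \<le> p" "q \<le> v" for p q
      using covers_inD[OF that(1)] that \<open>b \<le> u\<close> x ab by (auto simp: g_def)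
  qed
  have to_x: "el_interval S g u x" if u: "u \<in> T" "u \<le> a" for u
  proof (rule el_interval_glue)
    show "el_interval S g u a" using lower u ab by blast
    show "el_interval S g a x" using cov_ax by (rule el_interval_cover)
    show "g p q \<le> g p' q'"
      if "covers_in S p q" "q \<le> a" "covers_in S p' q'" "a \<le> p'" "q' \<le> x" for p q p' q'
    proof -
      have "q' = x" using below_x[of q'] covers_inD(2,3)[OF that(3)] that by auto
      then have "g p' q' = M" by (simp add: g_def)
      then show ?thesis using g_le[OF that(1)] that(2) ab by auto
    qed
    show "s \<le> a \<or> a \<le> s" if "s \<in> S" "s \<le> x" for s
      using below_x[OF that] ab by auto
  qed (use ab u in_S in auto)
  have from_x: "el_interval S g x v" if v: "v \<in> T" "b \<le> v" for v
  proof (rule el_interval_glue)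
    show "el_interval S g b v" using upper v ab by blast
    show "el_interval S g x b" using cov_xb by (rule el_interval_cover)
    show "g p q \<le> g p' q'"
      if "covers_in S p q" "x \<le> p" "q \<le> b" "covers_in S p' q'" "b \<le> p'" for p q p' q'
    proof -
      have "p = x" using above_x[of p] covers_inD(1,3)[OF that(1)] that by auto
      then have "g p q = M" by (simp add: g_def)
      then show ?thesis using g_ge[OF that(4)] that(5) ab by auto
    qed
    show "s \<le> b \<or> b \<le> s" if "s \<in> S" "x \<le> s" for s
      using above_x[OF that] ab by auto
  qed (use ab v in_S in auto)
  have through: "el_interval S g u v" if uv: "u \<in> T" "u \<le> a" "v \<in> T" "b \<le> v" for u v
  proof (rule el_interval_glue)
    show "el_interval S g u x" using to_x uv by blast
    show "el_interval S g x v" using from_x uv by blast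
    show "g p q \<le> g p' q'"
      if "covers_in S p q" "q \<le> x" "covers_in S p' q'" "x \<le> p'" for p q p' q'
      using g_le[OF that(1,2)] g_ge[OF that(3,4)] by linarith
    show "s \<le> x \<or> x \<le> s" if "s \<in> S" for s
      using comparable[of s] that ab by (auto simp: S_def)
  qed (use ab uv in_S in auto)
  have "el_interval S g u v" if uv: "u \<in> S" "v \<in> S" "u \<le> v" for u v
  proof -
    consider "u = x" "v = x" | "u = x" "v \<in> T" | "u \<in> T" "v = x" | "u \<in> T" "v \<in> T"
      using uv by (auto simp: S_def)
    then show ?thesis
    proof cases
      case 1
      then show ?thesis using uv by (auto intro: el_interval_refl)
    next
      case 2
      with comparable[of v] uv ab have "b \<le> v" by auto
      with 2 from_x show ?thesis by simp
    next
      case 3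
      with comparable[of u] uv ab have "u \<le> a" by auto
      with 3 to_x show ?thesis by simp
    next
      case 4
      with comparable[of u] comparable[of v] uv lower upper through show ?thesis
        by (meson order_trans)
    qed
  qed
  then show ?thesis unfolding el_labeling_def S_def by blast
qed

section \<open>Cycles in dismantlable lattices\<close>

text \<open>Dismantlability of a subset of a fixed ambient lattice, in a form that gives induction
  on the added elements. That the new element has at most one lower and one upper cover is derived
  below from closure under \<open>sup\<close> and \<open>inf\<close>.\<close>

inductive dismantlable_in :: "'a::lattice set \<Rightarrow> bool"
  where
    singleton: "dismantlable_in {x}"
  | insert: "dismantlable_in T \<Longrightarrow> x \<notin> T \<Longrightarrow> sublattice (insert x T) \<Longrightarrow>
      dismantlable_in (insert x T)"

lemma dismantlable_in_sublattice: "dismantlable_in S \<Longrightarrow> sublattice S"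
  by (induction rule: dismantlable_in.induct) (auto simp: sublattice_def)

lemma dismantlable_in_finite: "dismantlable_in S \<Longrightarrow> finite S"
  by (induction rule: dismantlable_in.induct) auto

text \<open>For a maximal \<open>a\<close> below \<open>x\<close> and any other \<open>s\<close>
  below \<open>x\<close>, the join \<open>sup a s\<close> is at most \<open>x\<close> and lies in
  \<open>T\<close>, hence differs from \<open>x\<close>; maximality gives
  \<open>s \<le> a\<close>.\<close>

lemma sublattice_greatest_below:
  assumes "sublattice T" "finite T" "x \<notin> T" "t \<in> T" "t < x"
  shows "\<exists>a\<in>T. a < x \<and> (\<forall>s\<in>T. s < x \<longrightarrow> s \<le> a)"
proof -
  have "finite {s\<in>T. s < x}" "{s\<in>T. s < x} \<noteq> {}" using assms by auto
  from finite_has_maximal[OF this] obtain a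
    where a: "a \<in> T" "a < x" and max: "\<And>s. s \<in> T \<Longrightarrow> s < x \<Longrightarrow> a \<le> s \<Longrightarrow> a = s" by auto
  have "s \<le> a" if "s \<in> T" "s < x" for s
  proof -
    have "sup a s \<in> T" using assms(1) a that by (auto simp: sublattice_def)
    moreover from this have "sup a s < x" using a that assms(3) by (metis le_sup_iff order_le_less)
    ultimately show ?thesis using max[of "sup a s"] by (metis sup_ge1 sup_ge2)
  qed
  with a show ?thesis by blast
qed

lemma sublattice_least_above:
  assumes "sublattice T" "finite T" "x \<notin> T" "t \<in> T" "x < t"
  shows "\<exists>b\<in>T. x < b \<and> (\<forall>s\<in>T. x < s \<longrightarrow> b \<le> s)"
proof -
  have "finite {s\<in>T. x < s}" "{s\<in>T. x < s} \<noteq> {}" using assms by auto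
  from finite_has_minimal[OF this] obtain b
    where b: "b \<in> T" "x < b" and min: "\<And>s. s \<in> T \<Longrightarrow> x < s \<Longrightarrow> s \<le> b \<Longrightarrow> b = s" by auto
  have "b \<le> s" if "s \<in> T" "x < s" for s
  proof -
    have "inf b s \<in> T" using assms(1) b that by (auto simp: sublattice_def)
    moreover from this have "x < inf b s" using b that assms(3) by (metis le_inf_iff order_le_less)
    ultimately show ?thesis using min[of "inf b s"] by (metis inf_le1 inf_le2)
  qed
  with b show ?thesis by blast
qed

text \<open>
  A crown satisfies this condition. Unlike crowns, these configurations need no cyclic indexing and
  no induced subgraphs.
\<close>

definition bipartite_core :: "'a::order set \<Rightarrow> 'a set \<Rightarrow> bool"
  where "bipartite_core A B \<longleftrightarrow> A \<noteq> {} \<and>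
    (\<forall>a\<in>A. \<exists>b\<in>B. \<exists>b'\<in>B. b \<noteq> b' \<and> a < b \<and> a < b') \<and>
    (\<forall>b\<in>B. \<exists>a\<in>A. \<exists>a'\<in>A. a \<noteq> a' \<and> a < b \<and> a' < b) \<and>
    (\<forall>a\<in>A. \<forall>a'\<in>A. \<forall>b\<in>B. \<forall>b'\<in>B.
      a < b \<longrightarrow> a < b' \<longrightarrow> a' < b \<longrightarrow> a' < b' \<longrightarrow> a = a' \<or> b = b')"

lemma bipartite_coreD:
  assumes "bipartite_core A B"
  shows "A \<noteq> {}"
    and "a \<in> A \<Longrightarrow> \<exists>b\<in>B. \<exists>b'\<in>B. b \<noteq> b' \<and> a < b \<and> a < b'"
    and "b \<in> B \<Longrightarrow> \<exists>a\<in>A. \<exists>a'\<in>A. a \<noteq> a' \<and> a < b \<and> a' < b"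
    and "a \<in> A \<Longrightarrow> a' \<in> A \<Longrightarrow> b \<in> B \<Longrightarrow> b' \<in> B \<Longrightarrow>
      a < b \<Longrightarrow> a < b' \<Longrightarrow> a' < b \<Longrightarrow> a' < b' \<Longrightarrow> a = a' \<or> b = b'"
  using assms unfolding bipartite_core_def by blast+

text \<open>Being a core depends only on the comparabilities between the two sides, so injective
  replacements that respect these carry a core to a core.\<close>

lemma bipartite_core_image:
  assumes core: "bipartite_core A B"
    and iff: "\<And>a b. a \<in> A \<Longrightarrow> b \<in> B \<Longrightarrow> \<phi> a < \<psi> b \<longleftrightarrow> a < b"
    and inj: "inj_on \<phi> A" "inj_on \<psi> B"
  shows "bipartite_core (\<phi> ` A) (\<psi> ` B)"
  unfolding bipartite_core_def
proof (intro conjI ballI impI)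
  show "\<phi> ` A \<noteq> {}" using bipartite_coreD(1)[OF core] by simp
  show "\<exists>b\<in>\<psi> ` B. \<exists>b'\<in>\<psi> ` B. b \<noteq> b' \<and> a < b \<and> a < b'" if "a \<in> \<phi> ` A" for a
  proof -
    from that obtain a0 where "a = \<phi> a0" "a0 \<in> A" by blast
    moreover from this bipartite_coreD(2)[OF core] obtain b b'
      where "b \<in> B" "b' \<in> B" "b \<noteq> b'" "a0 < b" "a0 < b'" by blast
    ultimately show ?thesis using iff inj(2) by (metis image_eqI inj_on_def)
  qed
  show "\<exists>a\<in>\<phi> ` A. \<exists>a'\<in>\<phi> ` A. a \<noteq> a' \<and> a < b \<and> a' < b" if "b \<in> \<psi> ` B" for b
  proof -
    from that obtain b0 where "b = \<psi> b0" "b0 \<in> B" by blast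
    moreover from this bipartite_coreD(3)[OF core] obtain a a'
      where "a \<in> A" "a' \<in> A" "a \<noteq> a'" "a < b0" "a' < b0" by blast
    ultimately show ?thesis using iff inj(1) by (metis image_eqI inj_on_def)
  qed
  show "a = a' \<or> b = b'"
    if "a \<in> \<phi> ` A" "a' \<in> \<phi> ` A" "b \<in> \<psi> ` B" "b' \<in> \<psi> ` B"
      "a < b" "a < b'" "a' < b" "a' < b'" for a a' b b'
  proof -
    from that obtain a0 a0' b0 b0' where
      "a = \<phi> a0" "a' = \<phi> a0'" "b = \<psi> b0" "b' = \<psi> b0'" "a0 \<in> A" "a0' \<in> A" "b0 \<in> B" "b0' \<in> B"
      by blast
    with that iff bipartite_coreD(4)[OF core, of a0 a0' b0 b0'] show ?thesis by auto
  qed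
qed

text \<open>
  Replacing the new element by its lower cover (on the upper side of the core) or its upper cover
  (on the lower side) moves a core into the smaller sublattice.
\<close>

lemma no_bipartite_core:
  "dismantlable_in S \<Longrightarrow> A \<subseteq> S \<Longrightarrow> B \<subseteq> S \<Longrightarrow> \<not> bipartite_core A B"
proof (induction arbitrary: A B rule: dismantlable_in.induct)
  case (singleton x)
  show ?case
  proof
    assume core: "bipartite_core A B"
    with bipartite_coreD(1,2)[OF core] singleton show False by blast
  qed
next
  case (insert T x)
  note T = dismantlable_in_sublattice[OF insert.hyps(1)] dismantlable_in_finite[OF insert.hyps(1)]
  show ?case
  proof
    assume core: "bipartite_core A B"
    note coreD = bipartite_coreD[OF core]
    \<comment> \<open>A common element \<open>c\<close> would have two elements of \<open>A\<close>
      below it and some \<open>b\<close> above it; these two would share the upper bounds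
      \<open>c\<close> and \<open>b\<close>.\<close>
    have disj: "A \<inter> B = {}"
    proof (rule ccontr)
      assume "A \<inter> B \<noteq> {}"
      then obtain c where c: "c \<in> A" "c \<in> B" by blast
      obtain b where b: "b \<in> B" "c < b" using coreD(2)[OF c(1)] by blast
      obtain a a' where "a \<in> A" "a' \<in> A" "a \<noteq> a'" "a < c" "a' < c"
        using coreD(3)[OF c(2)] by blast
      moreover from this b have "a < b" "a' < b" by auto
      ultimately show False using coreD(4)[of a a' c b] b c by auto
    qed
    consider "x \<in> B" "A \<subseteq> T" | "x \<in> A" "B \<subseteq> T" | "A \<subseteq> T" "B \<subseteq> T"
      using insert.prems disj by blast
    then show False
    proof cases
      case 1
      obtain a1 a2 where a12: "a1 \<in> A" "a2 \<in> A" "a1 \<noteq> a2" "a1 < x" "a2 < x"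
        using coreD(3)[OF 1(1)] by blast
      with sublattice_greatest_below[OF T insert.hyps(2), of a1] 1(2) obtain d
        where d: "d \<in> T" "d < x" "\<And>s. s \<in> T \<Longrightarrow> s < x \<Longrightarrow> s \<le> d" by blast
      \<comment> \<open>Otherwise \<open>d\<close> has a second upper neighbour \<open>b\<close>.
        Another element of \<open>A\<close> below \<open>x\<close> lies below \<open>d\<close>,
        hence below \<open>b\<close>, so it shares \<open>x\<close> and \<open>b\<close> with
        \<open>d\<close>.\<close>
      have "d \<notin> A"
      proof
        assume dA: "d \<in> A"
        obtain b where b: "b \<in> B" "b \<noteq> x" "d < b" using coreD(2)[OF dA] by metis
        obtain a where a: "a \<in> A" "a \<noteq> d" "a < x" using a12 by metis
        then have "a < b" using d(3)[of a] 1(2) b(3) by auto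
        with coreD(4)[of a d x b] a b d dA 1 show False by blast
      qed
      then have iff: "a < d \<longleftrightarrow> a < x" if "a \<in> A" for a
        using that 1(2) d by (metis order_le_less order_less_trans subsetD)
      \<comment> \<open>Otherwise \<open>a1\<close> and \<open>a2\<close> share the upper neighbours
        \<open>d\<close> and \<open>x\<close>. This makes the replacement of \<open>x\<close> by
        \<open>d\<close> injective on \<open>B\<close>.\<close>
      have "d \<notin> B"
        using coreD(4)[of a1 a2 d x] a12 iff 1(1) d(2) by auto
      let ?\<psi> = "\<lambda>b. if b = x then d else b"
      have "bipartite_core ((\<lambda>a. a) ` A) (?\<psi> ` B)"
        using core iff \<open>d \<notin> B\<close> by (intro bipartite_core_image) (auto simp: inj_on_def)
      moreover have "?\<psi> ` B \<subseteq> T" using insert.prems(2) d(1) by auto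
      ultimately show False using insert.IH[of A "?\<psi> ` B"] 1(2) by simp
    next
      case 2
      obtain b1 b2 where b12: "b1 \<in> B" "b2 \<in> B" "b1 \<noteq> b2" "x < b1" "x < b2"
        using coreD(2)[OF 2(1)] by blast
      with sublattice_least_above[OF T insert.hyps(2), of b1] 2(2) obtain d
        where d: "d \<in> T" "x < d" "\<And>s. s \<in> T \<Longrightarrow> x < s \<Longrightarrow> d \<le> s" by blast
      have "d \<notin> B"
      proof
        assume dB: "d \<in> B"
        obtain a where a: "a \<in> A" "a \<noteq> x" "a < d" using coreD(3)[OF dB] by metis
        obtain b where b: "b \<in> B" "b \<noteq> d" "x < b" using b12 by metis
        then have "a < b" using d(3)[of b] 2(2) a(3) by auto
        with coreD(4)[of a x d b] a b d dB 2 show False by blast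
      qed
      then have iff: "d < b \<longleftrightarrow> x < b" if "b \<in> B" for b
        using that 2(2) d by (metis order_le_less order_less_trans subsetD)
      have "d \<notin> A"
        using coreD(4)[of d x b1 b2] b12 iff 2(1) d(2) by auto
      let ?\<phi> = "\<lambda>a. if a = x then d else a"
      have "bipartite_core (?\<phi> ` A) ((\<lambda>b. b) ` B)"
        using core iff \<open>d \<notin> A\<close> by (intro bipartite_core_image) (auto simp: inj_on_def)
      moreover have "?\<phi> ` A \<subseteq> T" using insert.prems(1) d(1) by auto
      ultimately show False using insert.IH[of "?\<phi> ` A" B] 2(2) by simp
    next
      case 3
      with insert.IH core show False by blast
    qed
  qed
qed

section \<open>Paths and cycles in a symmetric relation\<close>

lemma rtrancl_avoid_leaf:
  assumes "(u, v) \<in> E\<^sup>*" and "u \<noteq> x" "v \<noteq> x" and "sym E"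
    and leaf: "\<And>w w'. (x, w) \<in> E \<Longrightarrow> (x, w') \<in> E \<Longrightarrow> w = w'"
  shows "(u, v) \<in> {(p, q) \<in> E. p \<noteq> x \<and> q \<noteq> x}\<^sup>*"
proof -
  let ?F = "{(p, q) \<in> E. p \<noteq> x \<and> q \<noteq> x}"
  \<comment> \<open>While the walk stands at \<open>x\<close>, the invariant remembers the neighbour
    it came from. The leaf \<open>x\<close> can only be left to that same neighbour, so the detour
    is dropped.\<close>
  have "(v \<noteq> x \<longrightarrow> (u, v) \<in> ?F\<^sup>*) \<and> (v = x \<longrightarrow> (\<exists>w. (w, x) \<in> E \<and> (u, w) \<in> ?F\<^sup>*))"
    using assms(1)
  proof (induction rule: rtrancl_induct)
    case base
    with assms(2) show ?case by simp
  next
    case (step v w)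
    show ?case
    proof (cases "v = x")
      case False
      with step have "(u, v) \<in> ?F\<^sup>*" by simp
      with step.hyps(2) False show ?thesis by (auto intro: rtrancl_into_rtrancl)
    next
      case True
      with step.IH obtain w0 where w0: "(w0, x) \<in> E" "(u, w0) \<in> ?F\<^sup>*" by blast
      then have "w0 = w" using leaf step.hyps(2) True \<open>sym E\<close> by (auto dest: symD)
      with w0 show ?thesis by auto
    qed
  qed
  with assms(3) show ?thesis by blast
qed

lemma rtrancl_distinct_path:
  assumes "(a, b) \<in> E\<^sup>*"
  shows "\<exists>p. p \<noteq> [] \<and> hd p = a \<and> last p = b \<and> distinct p \<and> successively (\<lambda>u v. (u, v) \<in> E) p"
  using assms
proof (induction rule: converse_rtrancl_induct)
  case base
  show ?case by (rule exI[of _ "[b]"]) simp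
next
  case (step a c)
  then obtain p where p: "p \<noteq> []" "hd p = c" "last p = b" "distinct p"
    "successively (\<lambda>u v. (u, v) \<in> E) p" by blast
  show ?case
  proof (cases "a \<in> set p")
    case True
    then obtain ys zs where "p = ys @ a # zs" by (meson split_list)
    with p show ?thesis by (intro exI[of _ "a # zs"]) (auto simp: successively_append_iff)
  next
    case False
    with p step.hyps(1) show ?thesis
      by (intro exI[of _ "a # p"]) (auto simp: successively_Cons)
  qed
qed

text \<open>A simple path from \<open>a\<close> to \<open>b\<close> that avoids their edge closes up
  with this edge to a cycle. Only the vertex set is kept, with two neighbours for each vertex, which
  is the form that \<open>bipartite_core\<close> asks for.\<close>

lemma cycle_through_edge:
  assumes "sym E" "a \<noteq> b" "(a, b) \<in> E" "(a, b) \<in> (E - {(a, b), (b, a)})\<^sup>*"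
  shows "\<exists>W. a \<in> W \<and> (\<forall>w\<in>W. \<exists>u\<in>W. \<exists>v\<in>W. u \<noteq> v \<and> (w, u) \<in> E \<and> (w, v) \<in> E)"
proof -
  from rtrancl_distinct_path[OF assms(4)] obtain p
    where p: "p \<noteq> []" "hd p = a" "last p = b" "distinct p"
      and adj: "successively (\<lambda>u v. (u, v) \<in> E - {(a, b), (b, a)}) p" by blast
  obtain q where q: "p = a # q @ [b]"
    using p assms(2) by (cases p; cases "tl p" rule: rev_cases) auto
  \<comment> \<open>An empty interior would mean that the path uses the removed edge.\<close>
  with adj have "q \<noteq> []" by auto
  have E: "(v, u) \<in> E" if "(u, v) \<in> E" for u v
    using that assms(1) by (auto dest: symD)
  have "\<exists>u\<in>set p. \<exists>v\<in>set p. u \<noteq> v \<and> (w, u) \<in> E \<and> (w, v) \<in> E" if w: "w \<in> set p" for w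
  proof -
    consider "w = a" | "w = b" | "w \<in> set q" using w q by auto
    then show ?thesis
    proof cases
      case 1
      have "(a, hd q) \<in> E" "hd q \<in> set q" "hd q \<noteq> b"
        using adj q \<open>q \<noteq> []\<close> p(4) by (auto simp: successively_Cons)
      with 1 assms(3) q show ?thesis by auto
    next
      case 2
      have "(last q, b) \<in> E" "last q \<in> set q" "last q \<noteq> a"
        using adj q \<open>q \<noteq> []\<close> p(4)
        by (auto simp: successively_Cons successively_append_iff hd_append)
      with 2 assms(3) q E show ?thesis by auto
    next
      case 3
      then obtain ys zs where "q = ys @ w # zs" by (meson split_list)
      with q have dec: "p = (a # ys) @ w # (zs @ [b])" by simp
      define us vs where "us = a # ys" and "vs = zs @ [b]"
      then have ne: "us \<noteq> []" "vs \<noteq> []" and dec': "p = us @ w # vs" using dec by auto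
      from adj ne have "(last us, w) \<in> E" "(w, hd vs) \<in> E"
        unfolding dec' by (simp_all add: successively_append_iff successively_Cons)
      moreover have uv: "last us \<in> set us" "hd vs \<in> set vs" using ne by auto
      moreover from this p(4) have "last us \<noteq> hd vs" unfolding dec' by auto
      moreover from uv have "last us \<in> set p" "hd vs \<in> set p" unfolding dec' by auto
      ultimately show ?thesis using E by blast
    qed
  qed
  moreover have "a \<in> set p" using q by simp
  ultimately show ?thesis by blast
qed

section \<open>Removing an element from a rank-connected sublattice\<close>

text \<open>Comparabilities are used in place of covers. Between consecutive levels the two agree
  once the level function is strictly monotone, and comparability does not change with
  \<open>S\<close>.\<close>

definition level_edges :: "'a::order set \<Rightarrow> ('a \<Rightarrow> nat) \<Rightarrow> nat \<Rightarrow> nat \<Rightarrow> ('a \<times> 'a) set"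
  where "level_edges S \<rho> p q = {(u, v). u \<in> S \<and> v \<in> S \<and>
    (\<rho> u = p \<and> \<rho> v = q \<and> u < v \<or> \<rho> v = p \<and> \<rho> u = q \<and> v < u)}"

text \<open>
  Levels may be skipped: the removal of an element that is alone in its level then preserves the
  level function.
\<close>

definition consecutive :: "'a set \<Rightarrow> ('a \<Rightarrow> nat) \<Rightarrow> nat \<Rightarrow> nat \<Rightarrow> bool"
  where "consecutive S \<rho> p q \<longleftrightarrow> p < q \<and> (\<forall>s\<in>S. \<not> (p < \<rho> s \<and> \<rho> s < q))"

text \<open>The form of rank-connectedness that survives the removal of elements. The level function
  is kept fixed, so the rank of the whole lattice serves for all its sublattices.\<close>

definition level_connected :: "'a::order set \<Rightarrow> ('a \<Rightarrow> nat) \<Rightarrow> bool"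
  where "level_connected S \<rho> \<longleftrightarrow>
    (\<forall>u v. covers_in S u v \<longrightarrow> consecutive S \<rho> (\<rho> u) (\<rho> v)) \<and>
    (\<forall>u\<in>S. \<forall>v\<in>S. consecutive S \<rho> (\<rho> u) (\<rho> v) \<longrightarrow>
      (u, v) \<in> (level_edges S \<rho> (\<rho> u) (\<rho> v))\<^sup>*)"

lemma sym_level_edges: "sym (level_edges S \<rho> p q)"
  by (auto simp: level_edges_def sym_def)

lemma cover_below:
  assumes "finite S" "u \<in> S" "v \<in> S" "u < v"
  shows "\<exists>w. covers_in S u w \<and> w \<le> v"
proof -
  have "finite {w\<in>S. u < w \<and> w \<le> v}" "{w\<in>S. u < w \<and> w \<le> v} \<noteq> {}" using assms by auto
  from finite_has_minimal[OF this] obtain w where w: "w \<in> S" "u < w" "w \<le> v"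
    and min: "\<And>z. z \<in> S \<Longrightarrow> u < z \<Longrightarrow> z \<le> v \<Longrightarrow> z \<le> w \<Longrightarrow> w = z" by auto
  have "covers_in S u w"
    unfolding covers_in_def
    using w assms(2) min by (metis less_imp_le less_irrefl order_trans)
  with w show ?thesis by blast
qed

text \<open>Each cover raises the level, so one can climb from \<open>u\<close> by covers; a maximal
  element \<open>m\<close> reached below \<open>v\<close> must be \<open>v\<close> itself.\<close>

lemma level_connected_strict_mono:
  assumes "level_connected S \<rho>" "finite S" "u \<in> S" "v \<in> S" "u < v"
  shows "\<rho> u < \<rho> v"
proof -
  let ?M = "{m\<in>S. u \<le> m \<and> m \<le> v \<and> (m = u \<or> \<rho> u < \<rho> m)}"
  have "u \<in> ?M" "finite ?M" using assms by auto
  then obtain m where m: "m \<in> ?M" and max: "\<And>z. z \<in> ?M \<Longrightarrow> m \<le> z \<Longrightarrow> m = z"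
    using finite_has_maximal[of ?M] by blast
  have "m = v"
  proof (rule ccontr)
    assume "m \<noteq> v"
    with m have "m < v" by auto
    with m cover_below[of S m v] assms obtain w where w: "covers_in S m w" "w \<le> v" by auto
    with assms(1) have "\<rho> m < \<rho> w" by (auto simp: level_connected_def consecutive_def)
    with m w covers_inD[OF w(1)] have "w \<in> ?M" by auto
    from max[OF this] covers_inD(3)[OF w(1)] show False by (metis less_imp_le less_irrefl)
  qed
  with m assms(5) show ?thesis by auto
qed

text \<open>Take a maximal \<open>m\<close> between \<open>u\<close> and \<open>v\<close> whose
  level does not exceed that of \<open>x\<close>. A cover of \<open>m\<close> below \<open>v\<close>
  has a higher level than \<open>x\<close>, and covers do not skip the occupied level of
  \<open>x\<close>.\<close>

lemma level_connected_crossing: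
  assumes "level_connected S \<rho>" "finite S" "u \<in> S" "v \<in> S" "x \<in> S"
    and "u \<le> v" "\<rho> u < \<rho> x" "\<rho> x < \<rho> v"
  shows "\<exists>m\<in>S. u \<le> m \<and> m \<le> v \<and> \<rho> m = \<rho> x"
proof -
  let ?M = "{m\<in>S. u \<le> m \<and> m \<le> v \<and> \<rho> m \<le> \<rho> x}"
  have "u \<in> ?M" "finite ?M" using assms by auto
  then obtain m where m: "m \<in> ?M" and max: "\<And>z. z \<in> ?M \<Longrightarrow> m \<le> z \<Longrightarrow> m = z"
    using finite_has_maximal[of ?M] by blast
  have "m < v" using m assms(8) by (auto simp: order_le_less)
  with m cover_below[of S m v] assms obtain w where w: "covers_in S m w" "w \<le> v" by auto
  have "w \<notin> ?M" using max[of w] covers_inD(3)[OF w(1)] by (metis less_imp_le less_irrefl)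
  with m w covers_inD[OF w(1)] have "\<rho> x < \<rho> w" by auto
  moreover have "consecutive S \<rho> (\<rho> m) (\<rho> w)"
    using assms(1) w by (simp add: level_connected_def)
  ultimately have "\<rho> m = \<rho> x" using m assms(5) by (auto simp: consecutive_def)
  with m show ?thesis by blast
qed

text \<open>One induction step, read downwards: the level condition is known for \<open>T\<close>
  together with \<open>x\<close> and is to be passed on to \<open>T\<close>.\<close>

locale level_connected_insert =
  fixes T :: "'a::lattice set" and x :: 'a and \<rho> :: "'a \<Rightarrow> nat"
  assumes dismantlable: "dismantlable_in T" and new: "x \<notin> T"
    and sublattice_S: "sublattice (insert x T)" and connected_S: "level_connected (insert x T) \<rho>"
begin

definition "S = insert x T"

text \<open>A predicate instead of a function of \<open>x\<close>, because \<open>x\<close> may have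
  no lower neighbour; likewise for \<open>upper\<close>.\<close>

definition "lower a \<longleftrightarrow> a \<in> T \<and> a < x \<and> (\<forall>s\<in>T. s < x \<longrightarrow> s \<le> a)"

definition "upper b \<longleftrightarrow> b \<in> T \<and> x < b \<and> (\<forall>s\<in>T. x < s \<longrightarrow> b \<le> s)"

lemma finite_T: "finite T" and sublattice_T: "sublattice T"
  using dismantlable dismantlable_in_finite dismantlable_in_sublattice by auto

lemma finite_S: "finite S" and x_in_S: "x \<in> S" and T_subset_S: "t \<in> T \<Longrightarrow> t \<in> S"
  using finite_T by (auto simp: S_def)

lemma level_less: "u \<in> S \<Longrightarrow> v \<in> S \<Longrightarrow> u < v \<Longrightarrow> \<rho> u < \<rho> v"
  using level_connected_strict_mono connected_S finite_S unfolding S_def by blast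

lemma level_le: "u \<in> S \<Longrightarrow> v \<in> S \<Longrightarrow> u \<le> v \<Longrightarrow> \<rho> u \<le> \<rho> v"
  using level_less by (force simp: order_le_less)

lemma covers_consecutive: "covers_in S u v \<Longrightarrow> consecutive S \<rho> (\<rho> u) (\<rho> v)"
  using connected_S by (simp add: level_connected_def S_def)

lemma lower_exists: "t \<in> T \<Longrightarrow> t < x \<Longrightarrow> \<exists>a. lower a"
  using sublattice_greatest_below[OF sublattice_T finite_T new] unfolding lower_def by blast

lemma upper_exists: "t \<in> T \<Longrightarrow> x < t \<Longrightarrow> \<exists>b. upper b"
  using sublattice_least_above[OF sublattice_T finite_T new] unfolding upper_def by blast

lemma covers_lower: "lower a \<Longrightarrow> covers_in S a x"
  by (force simp: lower_def covers_in_def S_def)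

lemma covers_upper: "upper b \<Longrightarrow> covers_in S x b"
  by (force simp: upper_def covers_in_def S_def)

text \<open>Since \<open>b\<close> is least above \<open>x\<close>, it satisfies
  \<open>b \<le> w\<close>; a strict inequality would put the level of \<open>b\<close> between two
  consecutive levels.\<close>

lemma neighbour_above:
  assumes "consecutive S \<rho> (\<rho> x) q" "(x, w) \<in> level_edges S \<rho> (\<rho> x) q" "upper b"
  shows "w = b"
proof -
  have w: "w \<in> S" "\<rho> w = q" "x < w"
    using assms by (auto simp: level_edges_def consecutive_def)
  then have "b \<le> w" "b \<in> S" "x < b" using assms(3) by (auto simp: upper_def S_def)
  moreover have "\<not> b < w"
    using assms(1) level_less[of b w] level_less[of x b] x_in_S calculation w
    by (auto simp: consecutive_def)
  ultimately show ?thesis by (simp add: order_le_less)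
qed

lemma neighbour_below:
  assumes "consecutive S \<rho> p (\<rho> x)" "(x, w) \<in> level_edges S \<rho> p (\<rho> x)" "lower a"
  shows "w = a"
proof -
  have w: "w \<in> S" "\<rho> w = p" "w < x"
    using assms by (auto simp: level_edges_def consecutive_def)
  then have "w \<le> a" "a \<in> S" "a < x" using assms(3) by (auto simp: lower_def S_def)
  moreover have "\<not> w < a"
    using assms(1) level_less[of w a] level_less[of a x] x_in_S calculation w
    by (auto simp: consecutive_def)
  ultimately show ?thesis by (simp add: order_le_less)
qed

text \<open>An edge at \<open>x\<close> leads up to the upper neighbour when \<open>x\<close> lies
  in level \<open>p\<close> and down to the lower neighbour when \<open>x\<close> lies in level
  \<open>q\<close>. So paths between other elements can bypass \<open>x\<close>.\<close>

lemma leaf: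
  assumes pq: "consecutive S \<rho> p q"
    and edges: "(x, w) \<in> level_edges S \<rho> p q" "(x, w') \<in> level_edges S \<rho> p q"
  shows "w = w'"
proof -
  consider "\<rho> x = p" "x < w" "w \<in> T" | "\<rho> x = q" "w < x" "w \<in> T"
    using edges(1) by (auto simp: level_edges_def S_def)
  then show ?thesis
  proof cases
    case 1
    with upper_exists obtain b where "upper b" by blast
    with neighbour_above pq edges 1(1) show ?thesis by blast
  next
    case 2
    with lower_exists obtain a where "lower a" by blast
    with neighbour_below pq edges 2(1) show ?thesis by blast
  qed
qed

lemma path_avoiding_new:
  assumes "u \<in> T" "v \<in> T" "consecutive S \<rho> (\<rho> u) (\<rho> v)"
  shows "(u, v) \<in> (level_edges T \<rho> (\<rho> u) (\<rho> v))\<^sup>*"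
proof -
  let ?E = "level_edges S \<rho> (\<rho> u) (\<rho> v)"
  have "(u, v) \<in> ?E\<^sup>*"
    using connected_S assms by (simp add: level_connected_def S_def)
  then have "(u, v) \<in> {(p, q) \<in> ?E. p \<noteq> x \<and> q \<noteq> x}\<^sup>*"
    by (rule rtrancl_avoid_leaf) (use assms new leaf sym_level_edges in blast)+
  moreover have "{(p, q) \<in> ?E. p \<noteq> x \<and> q \<noteq> x} \<subseteq> level_edges T \<rho> (\<rho> u) (\<rho> v)"
    by (auto simp: level_edges_def S_def)
  ultimately show ?thesis by (meson rtrancl_mono subsetD)
qed

text \<open>
  Suppose that another element lies in the level of \<open>x\<close>. Then \<open>b\<close> has a lower neighbour other than
  \<open>x\<close>, and a path to it from \<open>a\<close> closes up with the edge from \<open>a\<close> to \<open>b\<close> to a cycle.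
\<close>

lemma alone_in_level:
  assumes a: "lower a" and b: "upper b" and gap: "\<And>z. z \<in> T \<Longrightarrow> \<not> (a < z \<and> z < b)"
    and t: "t \<in> T"
  shows "\<rho> t \<noteq> \<rho> x"
proof
  assume tx: "\<rho> t = \<rho> x"
  have ab: "a \<in> T" "b \<in> T" "a < b" using a b by (auto simp: lower_def upper_def)
  have ax: "consecutive S \<rho> (\<rho> a) (\<rho> x)" and xb: "consecutive S \<rho> (\<rho> x) (\<rho> b)"
    using covers_consecutive covers_lower covers_upper a b by blast+
  then have levels: "\<rho> a < \<rho> x" "\<rho> x < \<rho> b" by (auto simp: consecutive_def)
  have "(t, b) \<in> (level_edges T \<rho> (\<rho> t) (\<rho> b))\<^sup>*"
    using path_avoiding_new[OF t ab(2)] xb tx by simp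
  moreover have "t \<noteq> b" using tx levels by auto
  ultimately obtain y where "(y, b) \<in> level_edges T \<rho> (\<rho> t) (\<rho> b)" by (metis rtranclE)
  then have y: "y \<in> T" "\<rho> y = \<rho> x" "y < b" using tx levels by (auto simp: level_edges_def)
  \<comment> \<open>The graph \<open>H\<close> joins the level of \<open>a\<close> to the level of
    \<open>x\<close>, except that all elements of the latter below \<open>b\<close> are merged into
    \<open>b\<close>.\<close>
  define A where "A = {s\<in>T. \<rho> s = \<rho> a}"
  define B where "B = insert b {s\<in>T. \<rho> s = \<rho> x \<and> \<not> s < b}"
  define H where "H = {(u, v). u \<in> A \<and> v \<in> B \<and> u < v \<or> v \<in> A \<and> u \<in> B \<and> v < u}"
  let ?F = "H - {(a, b), (b, a)}"
  have aA: "a \<in> A" and bB: "b \<in> B" using ab by (auto simp: A_def B_def)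
  have disj: "A \<inter> B = {}" using levels by (auto simp: A_def B_def)
  have "(a, y) \<in> (level_edges T \<rho> (\<rho> a) (\<rho> x))\<^sup>*"
    using path_avoiding_new[OF ab(1) y(1)] ax y(2) by simp
  \<comment> \<open>The walk is followed in \<open>H\<close> without the edge from \<open>a\<close>
    to \<open>b\<close>, until it first enters an element below \<open>b\<close>, at which point
    \<open>b\<close> is reached instead. Since \<open>y < b\<close>, this happens at the latest at
    \<open>y\<close>.\<close>
  then have "(a, b) \<in> ?F\<^sup>* \<or> (a, y) \<in> ?F\<^sup>* \<and> (\<rho> y = \<rho> x \<longrightarrow> \<not> y < b)"
  proof (induction rule: rtrancl_induct)
    case base
    show ?case using levels by simp
  next
    case (step v w)
    then consider "(a, b) \<in> ?F\<^sup>*" | "(a, v) \<in> ?F\<^sup>*" "\<rho> v = \<rho> x \<longrightarrow> \<not> v < b" by blast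
    then show ?case
    proof cases
      case 2
      consider "v \<in> T" "w \<in> T" "\<rho> v = \<rho> a" "\<rho> w = \<rho> x" "v < w" "w < b"
        | "v \<in> T" "w \<in> T" "\<rho> v = \<rho> a" "\<rho> w = \<rho> x" "v < w" "\<not> w < b"
        | "v \<in> T" "w \<in> T" "\<rho> v = \<rho> x" "\<rho> w = \<rho> a" "w < v" "\<not> v < b"
        using step.hyps(2) 2 by (auto simp: level_edges_def)
      then show ?thesis
      proof cases
        case 1
        \<comment> \<open>From \<open>a\<close> the walk cannot step to an element below
          \<open>b\<close>, because nothing of \<open>T\<close> lies strictly between
          \<open>a\<close> and \<open>b\<close>. So the redirected edge is not the removed
          one.\<close>
        have "v \<noteq> a" using gap[of w] 1 by auto
        moreover have "v < b" using 1 by simp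
        ultimately have "(v, b) \<in> ?F" using 1 ab bB by (auto simp: H_def A_def)
        with 2(1) show ?thesis by (simp add: rtrancl_into_rtrancl)
      next
        case 2
        then have "(v, w) \<in> ?F" using levels by (auto simp: H_def A_def B_def)
        with \<open>(a, v) \<in> ?F\<^sup>*\<close> 2 show ?thesis by (simp add: rtrancl_into_rtrancl)
      next
        case 3
        then have "(v, w) \<in> ?F" using levels by (auto simp: H_def A_def B_def)
        with \<open>(a, v) \<in> ?F\<^sup>*\<close> 3 levels show ?thesis by (simp add: rtrancl_into_rtrancl)
      qed
    qed simp
  qed
  with y have "(a, b) \<in> ?F\<^sup>*" by blast
  moreover have "sym H" by (auto simp: H_def sym_def)
  moreover have "(a, b) \<in> H" "a \<noteq> b" using aA bB ab(3) by (auto simp: H_def)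
  ultimately obtain W where W: "a \<in> W"
    and deg: "\<And>w. w \<in> W \<Longrightarrow> \<exists>u\<in>W. \<exists>v\<in>W. u \<noteq> v \<and> (w, u) \<in> H \<and> (w, v) \<in> H"
    using cycle_through_edge[of H a b] by blast
  have "bipartite_core (W \<inter> A) (W \<inter> B)"
    unfolding bipartite_core_def
  proof (intro conjI ballI impI)
    show "W \<inter> A \<noteq> {}" using W aA by blast
    show "\<exists>v\<in>W \<inter> B. \<exists>v'\<in>W \<inter> B. v \<noteq> v' \<and> u < v \<and> u < v'" if "u \<in> W \<inter> A" for u
      using deg[of u] that disj unfolding H_def by blast
    show "\<exists>u\<in>W \<inter> A. \<exists>u'\<in>W \<inter> A. u \<noteq> u' \<and> u < v \<and> u' < v" if "v \<in> W \<inter> B" for v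
      using deg[of v] that disj unfolding H_def by blast
    \<comment> \<open>The join of \<open>u\<close> and \<open>u'\<close> lies above the level of
      \<open>a\<close> and below or equal to \<open>v\<close>, hence is \<open>v\<close>. Then
      \<open>v < v'\<close>, impossible both for \<open>v' = b\<close> and for \<open>v'\<close> in
      the level of \<open>v\<close>. Swapping \<open>v\<close> and \<open>v'\<close> arranges
      \<open>v \<noteq> b\<close>.\<close>
    have four: False
      if "u \<in> A" "u' \<in> A" "u \<noteq> u'" "v \<in> B" "v' \<in> B" "v \<noteq> v'" "v \<noteq> b"
        "u < v" "u < v'" "u' < v" "u' < v'" for u u' v v'
    proof -
      have v: "v \<in> T" "\<rho> v = \<rho> x" "\<not> v < b" and v': "v' \<in> T"
        and u: "u \<in> T" "u' \<in> T" "\<rho> u = \<rho> a" "\<rho> u' = \<rho> a"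
        using that ab by (auto simp: A_def B_def)
      have s: "sup u u' \<in> T" using sublattice_T u by (auto simp: sublattice_def)
      have "sup u u' \<noteq> u"
        using level_less[of u' u] u that(3) T_subset_S by (metis less_irrefl order_le_less sup_ge2)
      then have "u < sup u u'" by (metis order_le_less sup_ge1)
      then have "\<rho> a < \<rho> (sup u u')" using level_less[of u "sup u u'"] u s T_subset_S by simp
      moreover have "sup u u' \<le> v" "sup u u' \<le> v'" using that by auto
      moreover from this have "\<rho> (sup u u') \<le> \<rho> x"
        using level_le[of "sup u u'" v] s v T_subset_S by simp
      ultimately have "\<rho> (sup u u') = \<rho> x"
        using ax s T_subset_S by (auto simp: consecutive_def)
      then have "sup u u' = v"
        using level_less[of "sup u u'" v] \<open>sup u u' \<le> v\<close> s v T_subset_S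
        by (auto simp: order_le_less)
      with \<open>sup u u' \<le> v'\<close> that(6) have "v < v'" by auto
      with v(3) have "v' \<noteq> b" by auto
      with that(5) have "\<rho> v' = \<rho> v" using v(2) by (auto simp: B_def)
      with level_less[OF _ _ \<open>v < v'\<close>] v v' T_subset_S show False by auto
    qed
    show "u = u' \<or> v = v'"
      if "u \<in> W \<inter> A" "u' \<in> W \<inter> A" "v \<in> W \<inter> B" "v' \<in> W \<inter> B"
        "u < v" "u < v'" "u' < v" "u' < v'" for u u' v v'
      using four[of u u' v v'] four[of u u' v' v] that by blast
  qed
  moreover have "W \<inter> A \<subseteq> T" "W \<inter> B \<subseteq> T" using ab by (auto simp: A_def B_def)
  ultimately show False using no_bipartite_core[OF dismantlable] by blast
qed

text \<open>If \<open>t\<close> has a lower level than \<open>x\<close> but is not below it, then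
  \<open>x < sup t x\<close>, so the interval from \<open>t\<close> to \<open>sup t x\<close>
  crosses the level of \<open>x\<close>. The crossing point can only be \<open>x\<close>. The other
  claim is dual, with the meet.\<close>

lemma alone_comparable:
  assumes alone: "\<And>t. t \<in> T \<Longrightarrow> \<rho> t \<noteq> \<rho> x" and t: "t \<in> T"
  shows "\<rho> t < \<rho> x \<Longrightarrow> t < x" and "\<rho> x < \<rho> t \<Longrightarrow> x < t"
proof -
  have tS: "t \<in> S" and inf: "inf t x \<in> S" and sup: "sup t x \<in> S"
    using t sublattice_S by (auto simp: S_def sublattice_def)
  have neq: "t \<noteq> x" using t new by blast
  have cross: "u \<le> x \<and> x \<le> v"
    if uv: "u \<in> S" "v \<in> S" "u \<le> v" "\<rho> u < \<rho> x" "\<rho> x < \<rho> v" for u v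
  proof -
    have "level_connected S \<rho>" using connected_S by (simp add: S_def)
    then obtain m where "m \<in> S" "u \<le> m" "m \<le> v" "\<rho> m = \<rho> x"
      using level_connected_crossing[of S \<rho> u v x] uv finite_S x_in_S by blast
    with alone show ?thesis by (auto simp: S_def)
  qed
  show "t < x" if "\<rho> t < \<rho> x"
  proof (rule ccontr)
    assume "\<not> t < x"
    with neq have "x < sup t x" by (metis order_le_less sup_ge1 sup_ge2)
    with level_less[OF x_in_S sup] cross[OF tS sup] that have "t \<le> x" by simp
    with neq \<open>\<not> t < x\<close> show False by simp
  qed
  show "x < t" if "\<rho> x < \<rho> t"
  proof (rule ccontr)
    assume "\<not> x < t"
    with neq have "inf t x < x" by (metis inf_le1 inf_le2 order_le_less)
    with level_less[OF inf x_in_S] cross[OF inf tS] that have "x \<le> t" by simp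
    with neq \<open>\<not> x < t\<close> show False by simp
  qed
qed

lemma covers_in_T_imp_S:
  assumes "covers_in T u v" "\<not> (u < x \<and> x < v)"
  shows "covers_in S u v"
  using assms by (auto simp: covers_in_def S_def)

lemma consecutive_T_iff_S:
  assumes "\<not> (p < \<rho> x \<and> \<rho> x < q)"
  shows "consecutive T \<rho> p q \<longleftrightarrow> consecutive S \<rho> p q"
  using assms by (auto simp: consecutive_def S_def)

text \<open>Covers of \<open>T\<close> are still covers of \<open>S\<close>, and paths can bypass
  \<open>x\<close>. What remains to be excluded is that the removal empties the level of
  \<open>x\<close> between two levels that thereby become consecutive.\<close>

lemma level_connected_no_cover:
  assumes nocov: "\<And>u v. covers_in T u v \<Longrightarrow> \<not> (u < x \<and> x < v)"
  shows "level_connected T \<rho>"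
  unfolding level_connected_def
proof (intro conjI allI ballI impI)
  show "consecutive T \<rho> (\<rho> u) (\<rho> v)" if "covers_in T u v" for u v
    using covers_consecutive[OF covers_in_T_imp_S[OF that nocov[OF that]]] T_subset_S
    by (auto simp: consecutive_def)
  fix u v
  assume uv: "u \<in> T" "v \<in> T" "consecutive T \<rho> (\<rho> u) (\<rho> v)"
  \<comment> \<open>The meet with \<open>u\<close> and the join with \<open>v\<close> show that
    \<open>x\<close> has neighbours \<open>a\<close> and \<open>b\<close> on both sides. They are
    not a covering pair of \<open>T\<close>, so some \<open>z\<close> of \<open>T\<close> lies
    strictly between them, and its level can only be that of \<open>x\<close>.\<close>
  have "\<not> (\<rho> u < \<rho> x \<and> \<rho> x < \<rho> v)"
  proof
    assume between: "\<rho> u < \<rho> x \<and> \<rho> x < \<rho> v"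
    have "inf u x \<noteq> x" using between level_le[of x u] x_in_S uv(1) T_subset_S
      by (metis inf_le1 leD)
    moreover have "inf u x \<in> S" using sublattice_S uv(1) by (auto simp: S_def sublattice_def)
    ultimately have "inf u x \<in> T" "inf u x < x" by (auto simp: S_def less_le)
    then obtain a where a: "lower a" using lower_exists by blast
    have "sup v x \<noteq> x" using between level_le[of v x] x_in_S uv(2) T_subset_S
      by (metis leD sup_ge1)
    moreover have "sup v x \<in> S" using sublattice_S uv(2) by (auto simp: S_def sublattice_def)
    ultimately have "sup v x \<in> T" "x < sup v x" by (auto simp: S_def less_le)
    then obtain b where b: "upper b" using upper_exists by blast
    have "\<not> covers_in T a b" using nocov a b by (auto simp: lower_def upper_def)
    with a b obtain z where z: "z \<in> T" "a < z" "z < b"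
      by (auto simp: covers_in_def lower_def upper_def)
    then have "\<rho> a < \<rho> z" "\<rho> z < \<rho> b"
      using level_less a b T_subset_S by (auto simp: lower_def upper_def)
    then have "\<rho> z = \<rho> x"
      using covers_consecutive[OF covers_lower[OF a]] covers_consecutive[OF covers_upper[OF b]]
        T_subset_S[OF z(1)] unfolding consecutive_def by (metis linorder_neqE_nat)
    with between uv(3) z(1) show False by (auto simp: consecutive_def)
  qed
  then show "(u, v) \<in> (level_edges T \<rho> (\<rho> u) (\<rho> v))\<^sup>*"
    using path_avoiding_new uv consecutive_T_iff_S by blast
qed

text \<open>The pair \<open>a\<close>, \<open>b\<close> must consist of the two neighbours of
  \<open>x\<close>, so \<open>x\<close> is alone in its level and comparable to everything. The
  levels of \<open>a\<close> and \<open>b\<close> become consecutive, and each contains only that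
  one element of \<open>T\<close>, so the edge between them suffices.\<close>

lemma level_connected_cover:
  assumes cov: "covers_in T a b" "a < x" "x < b"
  shows "level_connected T \<rho>" and "t \<in> T \<Longrightarrow> t \<le> a \<or> b \<le> t"
proof -
  obtain a' b' where ab': "lower a'" "upper b'"
    using lower_exists upper_exists cov covers_inD by blast
  have "a \<le> a'" "b' \<le> b" "a' < b'" "a' \<in> T" "b' \<in> T"
    using ab' cov covers_inD[OF cov(1)] by (auto simp: lower_def upper_def)
  then have "a = a'" "b = b'"
    using covers_inD(4)[OF cov(1)] ab' cov(2,3) unfolding lower_def upper_def
    by (metis order_le_less order_less_le_trans order_le_less_trans)+
  with ab' have ab: "lower a" "upper b" by auto
  have alone: "\<rho> s \<noteq> \<rho> x" if "s \<in> T" for s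
    using alone_in_level[OF ab] covers_inD(4)[OF cov(1)] that by blast
  have ax: "consecutive S \<rho> (\<rho> a) (\<rho> x)" and xb: "consecutive S \<rho> (\<rho> x) (\<rho> b)"
    using covers_consecutive covers_lower covers_upper ab by blast+
  have lower: "s \<le> a" if "s \<in> T" "\<rho> s < \<rho> x" for s
    using alone_comparable(1)[OF alone that] ab(1) that by (simp add: lower_def)
  have upper: "b \<le> s" if "s \<in> T" "\<rho> x < \<rho> s" for s
    using alone_comparable(2)[OF alone that] ab(2) that by (simp add: upper_def)
  show "t \<in> T \<Longrightarrow> t \<le> a \<or> b \<le> t"
    using lower upper alone by (meson linorder_neqE_nat)
  have cab: "consecutive T \<rho> (\<rho> a) (\<rho> b)"
    using ax xb alone T_subset_S unfolding consecutive_def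
    by (meson linorder_neqE_nat order_less_trans)
  show "level_connected T \<rho>"
    unfolding level_connected_def
  proof (intro conjI allI ballI impI)
    fix u v
    assume uv: "covers_in T u v"
    show "consecutive T \<rho> (\<rho> u) (\<rho> v)"
    proof (cases "u < x \<and> x < v")
      case True
      with uv ab have "u \<le> a" "b \<le> v" by (auto simp: covers_in_def lower_def upper_def)
      then have "u = a" "v = b"
        using covers_inD[OF uv] covers_inD[OF cov(1)]
        by (metis order_le_less order_less_le_trans order_le_less_trans)+
      with cab show ?thesis by simp
    next
      case False
      from covers_consecutive[OF covers_in_T_imp_S[OF uv False]] T_subset_S
      show ?thesis by (auto simp: consecutive_def)
    qed
  next
    fix u v
    assume uv: "u \<in> T" "v \<in> T" "consecutive T \<rho> (\<rho> u) (\<rho> v)"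
    show "(u, v) \<in> (level_edges T \<rho> (\<rho> u) (\<rho> v))\<^sup>*"
    proof (cases "\<rho> u < \<rho> x \<and> \<rho> x < \<rho> v")
      case True
      have T: "a \<in> T" "b \<in> T" "\<rho> a < \<rho> x" "\<rho> x < \<rho> b"
        using ax xb ab by (auto simp: consecutive_def lower_def upper_def)
      have "u \<le> a" "b \<le> v" using lower upper uv True by auto
      moreover have "\<not> u < a" "\<not> b < v"
        using level_less[of u a] level_less[of b v] uv T True T_subset_S
        by (auto simp: consecutive_def)
      ultimately have "u = a" "v = b" by (auto simp: order_le_less)
      then have "(u, v) \<in> level_edges T \<rho> (\<rho> u) (\<rho> v)"
        using T covers_inD(3)[OF cov(1)] by (simp add: level_edges_def)
      then show ?thesis by (rule r_into_rtrancl)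
    next
      case False
      with path_avoiding_new uv consecutive_T_iff_S show ?thesis by blast
    qed
  qed
qed

end

text \<open>The level condition travels down from the larger set to \<open>T\<close>, which makes
  the induction hypothesis applicable; the labeling it yields travels back up.\<close>

lemma dismantlable_el_labeling:
  fixes S :: "'a::{finite, lattice} set"
  assumes "dismantlable_in S" "level_connected S \<rho>"
  shows "\<exists>f. el_labeling S f"
  using assms
proof (induction rule: dismantlable_in.induct)
  case (singleton x)
  then show ?case by (auto simp: el_labeling_def intro: el_interval_refl)
next
  case (insert T x)
  interpret level_connected_insert T x \<rho>
    using insert by unfold_locales
  show ?case
  proof (cases "\<exists>a b. covers_in T a b \<and> a < x \<and> x < b")
    case True
    then obtain a b where ab: "covers_in T a b" "a < x" "x < b" by blast
    with insert.IH level_connected_cover(1) obtain f where "el_labeling T f" by blast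
    with el_labeling_insert_between[of T f x a b] ab level_connected_cover(2)[OF ab] new
    show ?thesis by (auto dest: covers_inD)
  next
    case False
    with insert.IH level_connected_no_cover obtain f where f: "el_labeling T f" by blast
    show ?thesis
    proof (rule el_labeling_insert[OF f new])
      show "\<exists>a\<in>T. a < x \<and> (\<forall>s\<in>T. s < x \<longrightarrow> s \<le> a)" if "t \<in> T" "t < x" for t
        using sublattice_greatest_below[OF sublattice_T finite_T new that] .
      show "\<exists>b\<in>T. x < b \<and> (\<forall>s\<in>T. x < s \<longrightarrow> b \<le> s)" if "t \<in> T" "x < t" for t
        using sublattice_least_above[OF sublattice_T finite_T new that] .
    qed (use False in blast)
  qed
qed

section \<open>Maximal chains and ranks\<close>

text \<open>A pointwise form of maximality: by inserting a single element, it is enough to test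
  elements comparable to the whole chain rather than larger chains.\<close>

lemma maximal_chain_iff:
  "maximal_chain x y C \<longleftrightarrow> C \<subseteq> {x..y} \<and> (\<forall>c\<in>C. \<forall>d\<in>C. c \<le> d \<or> d \<le> c) \<and>
    (\<forall>z\<in>{x..y}. (\<forall>c\<in>C. z \<le> c \<or> c \<le> z) \<longrightarrow> z \<in> C)"
  (is "_ \<longleftrightarrow> ?sub C \<and> ?tot C \<and> ?max")
proof -
  have chain: "pred_on.chain {x..y} (<) C \<longleftrightarrow> ?sub C \<and> ?tot C" for C
    unfolding pred_on.chain_def by (auto simp: order_le_less)
  show ?thesis
  proof
    assume mc: "maximal_chain x y C"
    then have C: "?sub C" "?tot C"
      and nosup: "\<And>S. ?sub S \<Longrightarrow> ?tot S \<Longrightarrow> \<not> C \<subset> S"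
      unfolding pred_on.maxchain_def chain by blast+
    have "z \<in> C" if z: "z \<in> {x..y}" "\<forall>c\<in>C. z \<le> c \<or> c \<le> z" for z
    proof (rule ccontr)
      assume "z \<notin> C"
      then have "C \<subset> insert z C" by blast
      moreover have "?sub (insert z C)" "?tot (insert z C)" using C z by auto
      ultimately show False using nosup by blast
    qed
    with C show "?sub C \<and> ?tot C \<and> ?max" by blast
  next
    assume C: "?sub C \<and> ?tot C \<and> ?max"
    have False if S: "?sub S" "?tot S" "C \<subset> S" for S
    proof -
      from S(3) obtain z where z: "z \<in> S" "z \<notin> C" by blast
      with S have "z \<in> {x..y}" "\<forall>c\<in>C. z \<le> c \<or> c \<le> z" by blast+
      with C z(2) show False by blast
    qed
    with C show "maximal_chain x y C" unfolding pred_on.maxchain_def chain by blast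
  qed
qed

lemma maximal_chain_exists: "\<exists>C. maximal_chain x y C"
  by (rule pred_on.Hausdorff)

lemma maximal_chain_ends:
  assumes "maximal_chain x y C" "x \<le> y"
  shows "x \<in> C" "y \<in> C"
proof -
  have "C \<subseteq> {x..y}" "\<And>z. z \<in> {x..y} \<Longrightarrow> \<forall>c\<in>C. z \<le> c \<or> c \<le> z \<Longrightarrow> z \<in> C"
    using assms(1) unfolding maximal_chain_iff by blast+
  moreover from this(1) have "\<forall>c\<in>C. x \<le> c" "\<forall>c\<in>C. c \<le> y" by auto
  moreover have "x \<in> {x..y}" "y \<in> {x..y}" using assms(2) by auto
  ultimately show "x \<in> C" "y \<in> C" by blast+
qed

text \<open>An element comparable to both chains is comparable to \<open>y\<close>, hence belongs to
  one of the two intervals. The chains share exactly \<open>y\<close>, so lengths, which count one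
  less than the elements, add up.\<close>

lemma maximal_chain_Un:
  fixes x y z :: "'a::{finite, order}"
  assumes C: "maximal_chain x y C" and D: "maximal_chain y z D" and le: "x \<le> y" "y \<le> z"
  shows "maximal_chain x z (C \<union> D)" "chain_length (C \<union> D) = chain_length C + chain_length D"
proof -
  note ends = maximal_chain_ends[OF C le(1)] maximal_chain_ends[OF D le(2)]
  note C' = C[unfolded maximal_chain_iff] and D' = D[unfolded maximal_chain_iff]
  have below: "c \<in> C \<Longrightarrow> x \<le> c \<and> c \<le> y" and above: "d \<in> D \<Longrightarrow> y \<le> d \<and> d \<le> z" for c d
    using C' D' by auto
  show "maximal_chain x z (C \<union> D)"
    unfolding maximal_chain_iff
  proof (intro conjI ballI impI)
    show "C \<union> D \<subseteq> {x..z}" using below above le by fastforce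
    show "c \<le> d \<or> d \<le> c" if "c \<in> C \<union> D" "d \<in> C \<union> D" for c d
      using that C' D' below above by (metis UnE order_trans)
    show "w \<in> C \<union> D" if "w \<in> {x..z}" "\<forall>c\<in>C \<union> D. w \<le> c \<or> c \<le> w" for w
    proof -
      have "w \<le> y \<or> y \<le> w" using that ends by blast
      with that C' D' show ?thesis by (meson UnI1 UnI2 atLeastAtMost_iff)
    qed
  qed
  have "C \<inter> D = {y}"
    using below above ends by (auto intro: antisym)
  then have "card (C \<union> D) + 1 = card C + card D"
    using card_Un_Int[of C D] by simp
  moreover have "card C > 0" "card D > 0" using ends by (auto simp: card_gt_0_iff)
  ultimately show "chain_length (C \<union> D) = chain_length C + chain_length D"
    by (simp add: chain_length_def)
qed

lemma maximal_chain_cover: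
  assumes "x \<lessdot> y"
  shows "maximal_chain x y {x, y}" "chain_length {x, y} = 1"
proof -
  have xy: "x < y" "\<And>z. x < z \<Longrightarrow> \<not> z < y" using assms by (auto simp: covered_by_def)
  then have "z \<in> {x, y}" if "z \<in> {x..y}" for z
    using that by (auto simp: order_le_less)
  with xy(1) show "maximal_chain x y {x, y}" unfolding maximal_chain_iff by auto
  show "chain_length {x, y} = 1" using xy(1) by (simp add: chain_length_def)
qed

text \<open>Two maximal chains up to \<open>x\<close>, prolonged by the same chain from
  \<open>x\<close> to \<open>top\<close>, have equal total length, and the common part cancels. This
  makes the \<open>THE\<close> in \<open>rank\<close> well defined.\<close>

lemma rank_eq:
  assumes ranked: "ranked TYPE('a::{finite, bounded_lattice})" and C: "maximal_chain bot (x :: 'a) C"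
  shows "rank x = chain_length C"
  unfolding rank_def
proof (rule the_equality)
  show "\<exists>C'. maximal_chain bot x C' \<and> chain_length C' = chain_length C" using C by blast
  obtain D where D: "maximal_chain x top D" using maximal_chain_exists by blast
  show "k = chain_length C" if "\<exists>C. maximal_chain bot x C \<and> chain_length C = k" for k
  proof -
    from that obtain C' where C': "maximal_chain bot x C'" "chain_length C' = k" by blast
    have "maximal_chain bot top (C \<union> D)" "maximal_chain bot top (C' \<union> D)"
      using maximal_chain_Un(1)[OF C D] maximal_chain_Un(1)[OF C'(1) D] by simp_all
    then have "chain_length (C \<union> D) = chain_length (C' \<union> D)"
      using ranked unfolding ranked_def by blast
    then show ?thesis
      using maximal_chain_Un(2)[OF C D] maximal_chain_Un(2)[OF C'(1) D] C'(2) by simp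
  qed
qed

lemma rank_cover:
  assumes "ranked TYPE('a::{finite, bounded_lattice})" and "(x :: 'a) \<lessdot> y"
  shows "rank y = Suc (rank x)"
proof -
  obtain C where C: "maximal_chain bot x C" using maximal_chain_exists by blast
  note D = maximal_chain_cover[OF assms(2)]
  have "x \<le> y" using assms(2) by (simp add: covered_by_def less_imp_le)
  with maximal_chain_Un[OF C D(1)] rank_eq[OF assms(1) C] rank_eq[OF assms(1), of y] D(2)
  show ?thesis by simp
qed

lemma rank_le_top:
  assumes "ranked TYPE('a::{finite, bounded_lattice})"
  shows "rank (x :: 'a) \<le> rank (top :: 'a)"
proof -
  obtain C where C: "maximal_chain bot x C" using maximal_chain_exists by blast
  obtain D where D: "maximal_chain x top D" using maximal_chain_exists by blast
  show ?thesis
    using maximal_chain_Un[OF C D] rank_eq[OF assms C] rank_eq[OF assms, of top] by simp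
qed

section \<open>Translation of the hypotheses and the conclusion\<close>

lemma covers_in_UNIV: "covers_in UNIV = (\<lessdot>)"
  by (auto simp: fun_eq_iff covers_in_def covered_by_def)

lemma rank_connected_imp_level_connected:
  assumes "rank_connected TYPE('a::{finite, bounded_lattice})"
  shows "level_connected (UNIV :: 'a set) rank"
proof -
  have ranked: "ranked TYPE('a)" using assms by (simp add: rank_connected_def)
  have path: "(u, v) \<in> (level_edges UNIV rank i (Suc i))\<^sup>*"
    if i: "i < rank (top :: 'a)" and uv: "u \<in> rank_level i" "v \<in> rank_level (Suc i)" for i and u v :: 'a
  proof -
    let ?L = "rank_level i \<union> rank_level (Suc i) :: 'a set"
    let ?G = "mk_symmetric (hasse_diagram \<restriction> ?L)"
    \<comment> \<open>Connectedness means reachability in the symmetrized diagram. Each edge of the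
      resulting walk joins the two different levels, because a cover raises the rank by exactly
      one.\<close>
    have "Digraph_Component.connected (hasse_diagram \<restriction> ?L)"
      using assms i unfolding rank_connected_def by blast
    then have "(u, v) \<in> rtrancl_on ?L (parcs ?G)"
      using uv by (simp add: connected_def strongly_connected_def reachable_def)
    then show ?thesis
    proof (induction rule: rtrancl_on_induct)
      case base
      show ?case by simp
    next
      case (step y z)
      have "y \<in> ?L" "z \<in> ?L" "y \<lessdot> z \<or> z \<lessdot> y"
        using step.hyps by (auto simp: mk_symmetric_def induce_subgraph_def hasse_diagram_def)
      moreover have "rank w = i \<and> rank w' = Suc i \<and> w < w'"
        if "w \<in> ?L" "w' \<in> ?L" "w \<lessdot> w'" for w w'
      proof -
        have "rank w' = Suc (rank w)" using rank_cover[OF ranked that(3)] .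
        with that show ?thesis by (auto simp: rank_level_def covered_by_def)
      qed
      ultimately have "(y, z) \<in> level_edges UNIV rank i (Suc i)"
        unfolding level_edges_def by blast
      with step.IH show ?case by (rule rtrancl_into_rtrancl)
    qed
  qed
  show ?thesis
    unfolding level_connected_def covers_in_UNIV
  proof (intro conjI allI ballI impI)
    show "consecutive (UNIV :: 'a set) rank (rank u) (rank v)" if "u \<lessdot> v" for u v :: 'a
      using rank_cover[OF ranked that] by (auto simp: consecutive_def)
    fix u v :: 'a
    assume cons: "consecutive (UNIV :: 'a set) rank (rank u) (rank v)"
    then have "rank u < rank v" by (simp add: consecutive_def)
    with rank_le_top[OF ranked, of v] have lt: "rank u < rank (top :: 'a)" by simp
    \<comment> \<open>Some element covers \<open>u\<close> and has rank one more than
      \<open>u\<close>; so ranks that are consecutive in the abstract sense differ by exactly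
      one.\<close>
    then have "u < top" by (metis less_irrefl top.not_eq_extremum)
    then obtain w where "u \<lessdot> w"
      using cover_below[of UNIV u top] by (auto simp: covers_in_UNIV)
    then have "rank w = Suc (rank u)" by (rule rank_cover[OF ranked])
    moreover have "\<not> (rank u < rank w \<and> rank w < rank v)"
      using cons unfolding consecutive_def by blast
    ultimately have "rank v = Suc (rank u)" using \<open>rank u < rank v\<close> by simp
    with path[OF lt] show "(u, v) \<in> (level_edges UNIV rank (rank u) (rank v))\<^sup>*"
      by (simp add: rank_level_def)
  qed
qed

lemma dismantlable_imp_dismantlable_in:
  assumes "dismantlable TYPE('a::{finite, bounded_lattice})"
  shows "dismantlable_in (UNIV :: 'a set)"
proof -
  obtain S :: "nat \<Rightarrow> 'a set"
    where S: "\<And>i. i \<in> {1..CARD('a)} \<Longrightarrow> sublattice (S i) \<and> card (S i) = i"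
      and chain: "\<And>i. i \<in> {1..<CARD('a)} \<Longrightarrow> S i \<subseteq> S (Suc i)" and "S CARD('a) = UNIV"
    using assms unfolding dismantlable_def by blast
  have "k \<le> CARD('a) \<longrightarrow> dismantlable_in (S k)" if "1 \<le> k" for k
    using that
  proof (induction k rule: nat_induct_at_least)
    case base
    \<comment> \<open>The chain of sublattices starts at index 1; its value at 0 is
      unconstrained.\<close>
    have "card (S 1) = 1" using S[of 1] zero_less_card_finite[where 'a = 'a] by simp
    then obtain x where "S 1 = {x}" by (auto simp: card_1_singleton_iff)
    then show ?case by (simp add: dismantlable_in.singleton)
  next
    case (Suc k)
    show ?case
    proof
      assume k: "Suc k \<le> CARD('a)"
      have "S k \<subseteq> S (Suc k)" "card (S (Suc k)) = Suc (card (S k))"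
        using chain[of k] S[of k] S[of "Suc k"] k Suc.hyps by auto
      then have "card (S (Suc k) - S k) = 1" by (simp add: card_Diff_subset)
      then obtain x where "S (Suc k) - S k = {x}" by (auto simp: card_1_singleton_iff)
      with \<open>S k \<subseteq> S (Suc k)\<close> have "S (Suc k) = insert x (S k)" "x \<notin> S k" by auto
      with Suc.IH S[of "Suc k"] k show "dismantlable_in (S (Suc k))"
        by (auto intro: dismantlable_in.insert)
    qed
  qed
  from this[of "CARD('a)"] \<open>S CARD('a) = UNIV\<close> show ?thesis
    using zero_less_card_finite[where 'a = 'a] by simp
qed

lemma el_labeling_imp_lexicographically_shellable:
  assumes "ranked TYPE('a::{finite, bounded_lattice})" "el_labeling (UNIV :: 'a set) f"
  shows "lexicographically_shellable TYPE('a)"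
proof -
  have "rising_in UNIV f x y xs \<longleftrightarrow> rising_chain f x y xs" for x y :: 'a and xs
    by (auto simp: rising_in_def chain_in_def rising_chain_def unrefinable_chain_def labels_def
      covers_in_UNIV)
  with assms(2) have "x \<le> y \<Longrightarrow> (\<exists>!xs. rising_chain f x y xs) \<and>
      (\<forall>xs z. rising_chain f x y xs \<longrightarrow> z \<le> y \<longrightarrow> x \<lessdot> z \<longrightarrow> z \<noteq> xs ! 1 \<longrightarrow>
        f x (xs ! 1) < f x z)" for x y :: 'a
    by (simp add: el_labeling_def el_interval_def covers_in_UNIV)
  with assms(1) show ?thesis
    unfolding lexicographically_shellable_def by (metis atLeastAtMost_iff)
qed

theorem theorem1:
  assumes "rank_connected TYPE('a::{finite, bounded_lattice})"
    and "dismantlable TYPE('a)"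
  shows "lexicographically_shellable TYPE('a)"
proof -
  obtain f where "el_labeling (UNIV :: 'a set) f"
    using dismantlable_el_labeling dismantlable_imp_dismantlable_in[OF assms(2)]
      rank_connected_imp_level_connected[OF assms(1)] by blast
  with assms(1) show ?thesis
    by (auto simp: rank_connected_def intro: el_labeling_imp_lexicographically_shellable)
qed

end
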